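(* Let $\rho(\mathbf v,\mathbf w)=\frac1{p^\dagger}\|\mathbf v-\mathbf w\|^2$ on $\mathbb R^{p^\dagger}$ (squared Euclidean distance). Assume the setup and Assumption 1 below, and: (i) $\frac1{p^\dagger}\sum_{l\in\mathcal R^\dagger}\mathbb E[u_{il}^2\mid\mathscr F]=\sigma^2$ for all $i\in[n]$; (ii) $\max_{i\in[n],l\in\mathcal R^\dagger}\mathbb E[|u_{il}|^{4+2\nu}\mid\mathscr F]<\infty$ a.s.; (iii) for every $\varepsilon>0$, $\lim_{\Delta\to0}\limsup_{n,p^\dagger\to\infty}\mathbb P\big\{\max_{i\in[n]}\max_{j:\rho(\mathbf H^\dagger_{\cdot i},\mathbf H^\dagger_{\cdot j})<\Delta}\|\boldsymbol\alpha_i-\boldsymbol\alpha_j\|>\varepsilon\big\}=0$; (iv) for some $\underline c>0$, $\lim_{n,p^\dagger\to\infty}\mathbb P\big\{\min_{i\in[n]}s_{\min}\big(\frac1{p^\dagger}\nabla\boldsymbol\eta^\dagger(\boldsymbol\alpha_i)'\nabla\boldsymbol\eta^\dagger(\boldsymbol\alpha_i)\big)\ge\underline c\big\}=1$. If $n^{4/\nu}(\log n)^{(\nu-2)/\nu}/p\lesssim1$, then Assumption 2 holds with $a_n=((\log n)/p)^{1/4}$, $\rho_0=2\sigma^2$, $\underline\varsigma=\bar\varsigma=2$.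
   Context: Setup: data form a $p\times n$ matrix $\mathbf X=\mathbf H+\mathbf U$ whose $i$th column is $\mathbf x_i=\boldsymbol\eta(\boldsymbol\alpha_i)+\mathbf u_i$, $i=1,\dots,n$, with entries $x_{il}$, where $\boldsymbol\alpha_i\in\mathbb R^r$ ($r$ fixed) are unobserved latent variables, $\boldsymbol\eta=(\eta_1,\dots,\eta_p)':\mathbb R^r\to\mathbb R^p$ are unobserved latent functions, $\mathbf H$ has $i$th column $\boldsymbol\eta(\boldsymbol\alpha_i)$, $\mathbf U$ has $i$th column $\mathbf u_i=(u_{i1},\dots,u_{ip})'$, and $\mathbb E[\mathbf u_i\mid\mathscr F]=0$, where $\mathscr F$ is the $\sigma$-field generated by $(\boldsymbol\alpha_i)_{i\le n}$ and $\boldsymbol\eta(\cdot)$. Asymptotics are as $n,p\to\infty$. Assumption 1: (a) $(\boldsymbol\alpha_i)_{i\le n}$ are i.i.d. with compact convex support $\mathcal A\subset\mathbb R^r$ and a density bounded and bounded away from zero on $\mathcal A$; (b) each $\eta_l$ is $\bar m$ times continuously differentiable for some $\bar m\ge 2$, with all partial derivatives of order at most $\bar m$ bounded by a constant not depending on $l$; (c) the $u_{il}$ are independent across $i$ and $l$ conditional on $\mathscr F$, and for some $\nu>0$, $\max_{i,l}\mathbb E[|u_{il}|^{2+\nu}\mid\mathscr F]<\infty$ a.s. Row splitting: the row index set is split into disjoint sets $[p]=\mathcal R^\dagger\cup\mathcal R^\ddagger$ with $p^\dagger=|\mathcal R^\dagger|\asymp p^\ddagger=|\mathcal R^\ddagger|\asymp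 p$; $\mathbf X^\dagger,\mathbf H^\dagger$ are the submatrices of $\mathbf X,\mathbf H$ with rows in $\mathcal R^\dagger$, and $\mathbf A_{\cdot i}$ denotes the $i$th column of $\mathbf A$. $\boldsymbol\eta^\dagger=(\eta_l)_{l\in\mathcal R^\dagger}$ and $\nabla\boldsymbol\eta^\dagger(\boldsymbol\alpha)$ is its $p^\dagger\times r$ Jacobian matrix; $s_{\min}$ denotes smallest singular value. Asymptotic notation: $a_n\lesssim_{\mathbb P}b_n$ means $\lim_{\varepsilon\to\infty}\limsup_n\mathbb P(|a_n/b_n|\ge\varepsilon)=0$; $a_n\gtrsim_{\mathbb P}b_n$ means $b_n\lesssim_{\mathbb P}a_n$; $a_n\lesssim b_n$ means $\limsup_n|a_n/b_n|<\infty$. Assumption 2 (Indirect matching): there exist fixed constants $\rho_0\ge0$, $\underline\varsigma>0$, $\bar\varsigma>0$ and a positive sequence $a_n=o(1)$ such that (a) $\max_{1\le i,j\le n}|\rho(\mathbf X^\dagger_{\cdot i},\mathbf X^\dagger_{\cdot j})-\rho(\mathbf H^\dagger_{\cdot i},\mathbf H^\dagger_{\cdot j})-\rho_0|\lesssim_{\mathbb P}a_n$; (b) $\max_{i,j:\boldsymbol\alpha_i\ne\boldsymbol\alpha_j}\rho(\mathbf H^\dagger_{\cdot i},\mathbf H^\dagger_{\cdot j})/\|\boldsymbol\alpha_i-\boldsymbol\alpha_j\|^{\bar\varsigma}\lesssim_{\mathbb P}1$ and $\min_{i,j:\boldsymbol\alpha_i\ne\boldsymbol\alpha_j}\rho(\mathbf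 H^\dagger_{\cdot i},\mathbf H^\dagger_{\cdot j})/\|\boldsymbol\alpha_i-\boldsymbol\alpha_j\|^{\underline\varsigma}\gtrsim_{\mathbb P}1$.
   Formalization: In Assumption 2(a) the maximum is taken over i ≠ j only: for i = j both distances vanish and the term equals 2σ², which is not O(a_n) when σ > 0. The conditional moment maxima are read as bounded by one a.s. finite random variable for all n, p. *)

theory Defs
  imports "HOL-Probability.Probability" "HOL-Library.Landau_Symbols"
begin

fun Cm_bdd :: "nat \<Rightarrow> real \<Rightarrow> (real^'r \<Rightarrow> real) \<Rightarrow> bool" where
  "Cm_bdd 0 B g = (continuous_on UNIV g \<and> (\<forall>x. \<bar>g x\<bar> \<le> B))"
| "Cm_bdd (Suc m) B g = (continuous_on UNIV g \<and> (\<forall>x. \<bar>g x\<bar> \<le> B) \<and>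
      g differentiable_on UNIV \<and>
      (\<forall>j. Cm_bdd m B (\<lambda>x. frechet_derivative g (at x) (axis j 1))))"

definition pderiv_at :: "(real^'r \<Rightarrow> real) \<Rightarrow> 'r \<Rightarrow> real^'r \<Rightarrow> real" where
  "pderiv_at g j x = frechet_derivative g (at x) (axis j 1)"

definition s_min :: "real^'m^'m \<Rightarrow> real" where
  "s_min A = Inf {norm (A *v x) | x. norm x = 1}"

definition rho_sq :: "nat set \<Rightarrow> (nat \<Rightarrow> real) \<Rightarrow> (nat \<Rightarrow> real) \<Rightarrow> real" where
  "rho_sq R v w = (1 / real (card R)) * (\<Sum>l\<in>R. (v l - w l)^2)"

definition latent_sigma :: "'a measure \<Rightarrow> nat \<Rightarrow> nat \<Rightarrow> (nat \<Rightarrow> 'a \<Rightarrow> real^'r)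
     \<Rightarrow> (nat \<Rightarrow> 'a \<Rightarrow> real^'r \<Rightarrow> real) \<Rightarrow> 'a measure" where
  "latent_sigma M n p alpha eta = sigma (space M)
     ({alpha i -` B \<inter> space M | i B. i < n \<and> B \<in> sets borel} \<union>
      {(\<lambda>\<omega>. eta l \<omega> x) -` B \<inter> space M | l x B. l < p \<and> B \<in> sets borel})"

definition cond_indep_vars :: "'a measure \<Rightarrow> 'a measure \<Rightarrow> ('i \<Rightarrow> 'a \<Rightarrow> real) \<Rightarrow> 'i set \<Rightarrow> bool" where
  "cond_indep_vars M F X I \<longleftrightarrow>
     (\<forall>J g. finite J \<and> J \<subseteq> I \<and>
        (\<forall>j\<in>J. g j \<in> borel_measurable borel \<and> (\<exists>C. \<forall>x. \<bar>g j x\<bar> \<le> C)) \<longrightarrow>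
        (AE \<omega> in M. real_cond_exp M F (\<lambda>\<omega>'. \<Prod>j\<in>J. g j (X j \<omega>')) \<omega>
                    = (\<Prod>j\<in>J. real_cond_exp M F (\<lambda>\<omega>'. g j (X j \<omega>')) \<omega>)))"

text \<open>A_k \<lesssim>_P B_k : lim_{eps\<rightarrow>\<infinity>} limsup_k P(|A_k / B_k| \<ge> eps) = 0
  (event written multiplicatively; values in ereal to allow max/min over empty sets).\<close>
definition lesssim_P :: "'a measure \<Rightarrow> (nat \<Rightarrow> 'a \<Rightarrow> ereal) \<Rightarrow> (nat \<Rightarrow> 'a \<Rightarrow> ereal) \<Rightarrow> bool" where
  "lesssim_P M A B \<longleftrightarrow>
     ((\<lambda>\<epsilon>::real. limsup (\<lambda>k. ereal (measure M {\<omega> \<in> space M. ereal \<epsilon> * \<bar>B k \<omega>\<bar> \<le> \<bar>A k \<omega>\<bar>})))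
        \<longlongrightarrow> 0) at_top"

definition gtrsim_P :: "'a measure \<Rightarrow> (nat \<Rightarrow> 'a \<Rightarrow> ereal) \<Rightarrow> (nat \<Rightarrow> 'a \<Rightarrow> ereal) \<Rightarrow> bool" where
  "gtrsim_P M A B \<longleftrightarrow> lesssim_P M B A"

text \<open>Assumption 2 (indirect matching) for given constants rho0, vs_lo, vs_hi and rate a.
  rhoX k i j, rhoH k i j are rho of columns i, j of X^dagger and H^dagger.\<close>
definition indirect_matching ::
  "'a measure \<Rightarrow> (nat \<Rightarrow> nat) \<Rightarrow> (nat \<Rightarrow> nat \<Rightarrow> nat \<Rightarrow> 'a \<Rightarrow> real) \<Rightarrow> (nat \<Rightarrow> nat \<Rightarrow> nat \<Rightarrow> 'a \<Rightarrow> real)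
    \<Rightarrow> (nat \<Rightarrow> nat \<Rightarrow> 'a \<Rightarrow> real^'r) \<Rightarrow> (nat \<Rightarrow> real) \<Rightarrow> real \<Rightarrow> real \<Rightarrow> real \<Rightarrow> bool" where
  "indirect_matching M n rhoX rhoH alpha a rho0 vs_lo vs_hi \<longleftrightarrow>
     rho0 \<ge> 0 \<and> vs_lo > 0 \<and> vs_hi > 0 \<and>
     (\<forall>\<^sub>F k in sequentially. a k > 0) \<and> (a \<longlonglongrightarrow> 0) \<and>
     lesssim_P M
       (\<lambda>k \<omega>. Sup (insert 0 {ereal \<bar>rhoX k i j \<omega> - rhoH k i j \<omega> - rho0\<bar> | i j. i < n k \<and> j < n k \<and> i \<noteq> j}))
       (\<lambda>k \<omega>. ereal (a k)) \<and>
     lesssim_P M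
       (\<lambda>k \<omega>. Sup (insert 0 {ereal (rhoH k i j \<omega> / norm (alpha k i \<omega> - alpha k j \<omega>) powr vs_hi) | i j.
                   i < n k \<and> j < n k \<and> alpha k i \<omega> \<noteq> alpha k j \<omega>}))
       (\<lambda>k \<omega>. 1) \<and>
     gtrsim_P M
       (\<lambda>k \<omega>. Inf {ereal (rhoH k i j \<omega> / norm (alpha k i \<omega> - alpha k j \<omega>) powr vs_lo) | i j.
                   i < n k \<and> j < n k \<and> alpha k i \<omega> \<noteq> alpha k j \<omega>})
       (\<lambda>k \<omega>. 1)"

end

(* The difference rho(X_i, X_j) - rho(H_i, H_j) - 2 sigma^2 is an average over the rows of centred
   squares u_il^2, of products u_il u_jl and of terms linear in the noise with bounded
   F-measurable coefficients. Truncating the noise at tau = p^(1/4) costs a probability of order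
   n p tau^(-(4 + 2 nu)) = n p^(-nu/2), which vanishes because the rate condition gives
   n = O(p^(nu/3)); the truncation bias is O(1/tau). For the truncated sums a conditional Chernoff
   bound with parameter of order 1/sqrt(p) shows that deviations of order p^(-1/4), which is at most
   the claimed rate, have probability exp(O(1) - c p^(1/4)), and this beats the union bound over
   n^2 pairs. All of this takes place on the F-measurable event that the conditional moments are
   at most K, whose probability tends to 1 as K grows, uniformly in the index.

   The upper comparison of rho(H_i, H_j) with |alpha_i - alpha_j|^2 is the Lipschitz bound. For the
   lower one, pairs of latent points at distance at least e0 are separated by (iii), and for closer
   pairs Taylor expansion reduces rho(H_i, H_j) to the quadratic form controlled by (iv). *)

theory Submission
  imports Defs "HOL-Real_Asymp.Real_Asymp"
begin

section \<open>Smooth functions and the geometry of the latent map\<close>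

text \<open>The level \<tau> = p^(1/4) comes from one balance. Products of two truncated variables
  reach \<tau>^2, so the Chernoff parameter can be at most of order \<tau>^(-2). The variance then
  contributes p/\<tau>^4 to the exponent, and a deviation of the mean by 1/\<tau> gains p/\<tau>^3.
  Taking \<tau>^4 = p keeps the former bounded and lets the latter grow like p^(1/4). The noise is
  not assumed integrable, since its conditional moments are bounded only by a random constant.
  Moments are therefore conditional expectations of nonnegative functions with values in
  [0, \<infinity>], and mean zero says that those of the positive and the negative part agree.
  Truncation does more than bound the summands: it makes real-valued conditional expectations
  legitimate. The event on which a fixed K bounds the moments is F-measurable, so its indicator can
  be carried through conditional expectations as a factor; its complement is paid for only once, in
  the final union bound.\<close>

lemma Cm_bdd_bounded: "Cm_bdd m B g \<Longrightarrow> \<bar>g x\<bar> \<le> B"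
  by (cases m) auto

lemma Cm_bdd_continuous: "Cm_bdd m B g \<Longrightarrow> continuous_on UNIV g"
  by (cases m) auto

lemma linear_axis_expand:
  fixes f :: "real^'r \<Rightarrow> real"
  assumes "linear f"
  shows "f h = (\<Sum>j\<in>UNIV. h $ j * f (axis j 1))"
proof -
  have "f h = f (\<Sum>j\<in>UNIV. (h $ j) *s axis j 1)"
    by (simp add: basis_expansion)
  also have "\<dots> = (\<Sum>j\<in>UNIV. h $ j * f (axis j 1))"
    using assms by (simp add: linear_sum linear_cmul scalar_mult_eq_scaleR)
  finally show ?thesis .
qed

lemma abs_linear_le_axis:
  fixes f :: "real^'r \<Rightarrow> real"
  assumes "linear f" "\<And>j. \<bar>f (axis j 1)\<bar> \<le> B"
  shows "\<bar>f h\<bar> \<le> (real CARD('r) * B) * norm h"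
proof -
  have "\<bar>f h\<bar> \<le> (\<Sum>j\<in>UNIV. \<bar>h $ j * f (axis j 1)\<bar>)"
    unfolding linear_axis_expand[OF assms(1), of h] by (rule sum_abs)
  also have "\<dots> \<le> (\<Sum>j\<in>(UNIV::'r set). norm h * B)"
    by (intro sum_mono) (auto simp: abs_mult intro!: mult_mono component_le_norm_cart assms(2))
  finally show ?thesis by (simp add: mult_ac)
qed

lemma Cm_bdd_has_derivative:
  "Cm_bdd (Suc m) B g \<Longrightarrow> (g has_derivative frechet_derivative g (at x)) (at x)"
  by (auto simp: differentiable_on_def frechet_derivative_works[symmetric])

lemma Cm_bdd_partial: "Cm_bdd (Suc m) B g \<Longrightarrow> \<bar>frechet_derivative g (at x) (axis j 1)\<bar> \<le> B"
  using Cm_bdd_bounded[of m B "\<lambda>x. frechet_derivative g (at x) (axis j 1)" x] by auto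

lemma Cm_bdd_Lipschitz:
  fixes g :: "real^'r \<Rightarrow> real"
  assumes "Cm_bdd (Suc m) B g"
  shows "\<bar>g y - g x\<bar> \<le> (real CARD('r) * B) * norm (y - x)"
proof -
  note D = Cm_bdd_has_derivative[OF assms]
  have "norm (g y - g x) \<le> (real CARD('r) * B) * norm (y - x)"
  proof (rule differentiable_bound[where S = UNIV and f' = "\<lambda>x. frechet_derivative g (at x)"])
    show "onorm (frechet_derivative g (at z)) \<le> real CARD('r) * B" for z
      by (rule onorm_le)
        (auto intro!: abs_linear_le_axis has_derivative_linear[OF D] Cm_bdd_partial[OF assms])
  qed (use D in auto)
  then show ?thesis by simp
qed

text \<open>The first partials are again \<open>Cm_bdd\<close>, hence Lipschitz, so along the
  segment the derivative moves by at most a constant times \<open>norm (y - x)\<close>. The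
  linearization bound then gives a quadratic error without a second-order expansion;
  \<open>m \<ge> 2\<close> is what makes the partials differentiable.\<close>

lemma Cm_bdd_Taylor:
  fixes g :: "real^'r \<Rightarrow> real"
  assumes "Cm_bdd m B g" "m \<ge> 2"
  shows "\<bar>g y - g x - frechet_derivative g (at x) (y - x)\<bar> \<le> (real CARD('r))\<^sup>2 * B * (norm (y - x))\<^sup>2"
proof -
  obtain m' where m: "m = Suc (Suc m')"
    using assms(2) by (metis numeral_2_eq_2 Suc_le_D Suc_le_mono)
  note g = assms(1)[unfolded m]
  note D = Cm_bdd_has_derivative[OF g]
  have B: "B \<ge> 0" using Cm_bdd_bounded[OF g, of x] by linarith
  let ?K = "real CARD('r) * B"
  have "norm (g y - g x - frechet_derivative g (at x) (y - x))
      \<le> norm (y - x) * (real CARD('r) * (?K * norm (y - x)))"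
  proof (rule differentiable_bound_linearization[where S = "closed_segment x y"])
    fix t :: real assume "t \<in> {0..1}"
    then show "x + t *\<^sub>R (y - x) \<in> closed_segment x y"
      by (auto simp: in_segment algebra_simps intro!: exI[of _ t])
  next
    fix z assume z: "z \<in> closed_segment x y"
    show "onorm (frechet_derivative g (at z) - frechet_derivative g (at x))
        \<le> real CARD('r) * (?K * norm (y - x))"
      unfolding fun_diff_def
    proof (rule onorm_le)
      fix h
      have "\<bar>frechet_derivative g (at z) (axis j 1) - frechet_derivative g (at x) (axis j 1)\<bar>
           \<le> ?K * norm (y - x)" for j
      proof -
        have "Cm_bdd (Suc m') B (\<lambda>x. frechet_derivative g (at x) (axis j 1))"
          using g by (subst (asm) Cm_bdd.simps(2)) blast
        from Cm_bdd_Lipschitz[OF this, of z x]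
        have "\<bar>frechet_derivative g (at z) (axis j 1) - frechet_derivative g (at x) (axis j 1)\<bar>
           \<le> ?K * norm (z - x)" .
        also have "\<dots> \<le> ?K * norm (y - x)"
          using segment_bound(1)[OF z] B by (intro mult_left_mono) (auto)
        finally show ?thesis .
      qed
      then show "norm (frechet_derivative g (at z) h - frechet_derivative g (at x) h)
          \<le> real CARD('r) * (?K * norm (y - x)) * norm h"
        unfolding real_norm_def
        by (rule abs_linear_le_axis[rotated])
          (rule linear_compose_sub[OF has_derivative_linear[OF D] has_derivative_linear[OF D]])
    qed
  qed (auto intro: has_derivative_at_withinI D)
  then show ?thesis by (simp add: power2_eq_square algebra_simps)
qed

lemma s_min_le: "s_min A * norm d \<le> norm (A *v d)"
proof (cases "d = 0")
  case False
  have "s_min A \<le> norm (A *v ((1 / norm d) *\<^sub>R d))"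
    unfolding s_min_def using False by (intro cInf_lower bdd_belowI[of _ 0]) auto
  also have "\<dots> = norm (A *v d) / norm d"
    by (simp add: matrix_vector_mult_scaleR)
  finally show ?thesis using False by (simp add: field_simps)
qed simp

lemma mean_sq_le:
  assumes "finite R"
  shows "(1 / real (card R) * (\<Sum>l\<in>R. f l))\<^sup>2 \<le> 1 / real (card R) * (\<Sum>l\<in>R. (f l)\<^sup>2)"
proof (cases "R = {}")
  case False
  have "(\<Sum>l\<in>R. f l)\<^sup>2 \<le> (\<Sum>l\<in>R. (f l)\<^sup>2) * real (card R)"
    by (rule sum_squared_le_sum_of_squares)
  then show ?thesis
    using False assms by (simp add: power_divide field_simps power2_eq_square card_gt_0_iff)
qed simp

text \<open>For \<open>G = J\<^sup>TJ / card R\<close>, Cauchy--Schwarz gives \<open>\<parallel>G d\<parallel>\<^sup>2 \<le> CARD('r) B\<^sup>2 \<parallel>J d\<parallel>\<^sup>2 / card R\<close>; this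
  avoids the spectral theorem at the price of a worse constant.\<close>

lemma gram_quadratic_lower:
  fixes D :: "nat \<Rightarrow> 'r::finite \<Rightarrow> real" and d :: "real^'r"
  assumes R: "finite R" and B: "\<And>l a. l \<in> R \<Longrightarrow> \<bar>D l a\<bar> \<le> B"
    and c: "c \<ge> 0" "s_min (\<chi> a b. (1 / real (card R)) * (\<Sum>l\<in>R. D l a * D l b)) \<ge> c"
  shows "c\<^sup>2 * (norm d)\<^sup>2
     \<le> real CARD('r) * B\<^sup>2 * (1 / real (card R) * (\<Sum>l\<in>R. (\<Sum>b\<in>UNIV. D l b * d $ b)\<^sup>2))"
proof -
  define q where "q l = (\<Sum>b\<in>UNIV. D l b * d $ b)" for l
  define G :: "real^'r^'r" where "G = (\<chi> a b. (1 / real (card R)) * (\<Sum>l\<in>R. D l a * D l b))"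
  have comp: "(G *v d) $ a = 1 / real (card R) * (\<Sum>l\<in>R. D l a * q l)" for a
  proof -
    have "(G *v d) $ a = (\<Sum>b\<in>UNIV. \<Sum>l\<in>R. 1 / real (card R) * (D l a * (D l b * d $ b)))"
      by (simp add: G_def matrix_vector_mult_def sum_distrib_left sum_distrib_right mult_ac sum_divide_distrib)
    also have "\<dots> = (\<Sum>l\<in>R. \<Sum>b\<in>UNIV. 1 / real (card R) * (D l a * (D l b * d $ b)))"
      by (rule sum.swap)
    finally show ?thesis by (simp add: q_def sum_distrib_left)
  qed
  have "((G *v d) $ a)\<^sup>2 \<le> B\<^sup>2 * (1 / real (card R) * (\<Sum>l\<in>R. (q l)\<^sup>2))" for a
  proof -
    have "((G *v d) $ a)\<^sup>2 \<le> 1 / real (card R) * (\<Sum>l\<in>R. (D l a * q l)\<^sup>2)"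
      unfolding comp by (rule mean_sq_le[OF R])
    also have "\<dots> \<le> 1 / real (card R) * (\<Sum>l\<in>R. B\<^sup>2 * (q l)\<^sup>2)"
    proof (intro mult_left_mono sum_mono)
      fix l assume "l \<in> R"
      then have "(D l a)\<^sup>2 \<le> B\<^sup>2" by (metis B abs_ge_zero power2_abs power_mono)
      then show "(D l a * q l)\<^sup>2 \<le> B\<^sup>2 * (q l)\<^sup>2"
        by (simp add: power_mult_distrib mult_right_mono)
    qed simp
    finally show ?thesis by (simp add: sum_distrib_left mult_ac)
  qed
  then have "(\<Sum>a\<in>UNIV. ((G *v d) $ a)\<^sup>2)
      \<le> (\<Sum>a\<in>(UNIV::'r set). B\<^sup>2 * (1 / real (card R) * (\<Sum>l\<in>R. (q l)\<^sup>2)))"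
    by (intro sum_mono) auto
  moreover have "(\<Sum>a\<in>UNIV. ((G *v d) $ a)\<^sup>2) = (norm (G *v d))\<^sup>2"
    by (simp add: norm_vec_def L2_set_def sum_nonneg)
  moreover have "c * norm d \<le> norm (G *v d)"
    using order_trans[OF mult_right_mono[OF c(2) norm_ge_zero] s_min_le] unfolding G_def .
  then have "(c * norm d)\<^sup>2 \<le> (norm (G *v d))\<^sup>2"
    using c(1) by (intro power_mono) auto
  ultimately show ?thesis
    unfolding q_def by (simp add: power_mult_distrib mult_ac)
qed

lemma rho_sq_Lipschitz:
  fixes g :: "nat \<Rightarrow> real^'r \<Rightarrow> real"
  assumes "\<And>l. l \<in> R \<Longrightarrow> Cm_bdd (Suc m) B (g l)"
  shows "rho_sq R (\<lambda>l. g l x) (\<lambda>l. g l y) \<le> (real CARD('r) * B)\<^sup>2 * (norm (x - y))\<^sup>2"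
\<comment> \<open>For \<open>card R = 0\<close> the factor \<open>1 / real (card R)\<close> is 0 and
  \<open>rho_sq\<close> vanishes, which covers empty and infinite \<open>R\<close> alike.\<close>
proof (cases "card R = 0")
  case False
  have "(g l x - g l y)\<^sup>2 \<le> (real CARD('r) * B)\<^sup>2 * (norm (x - y))\<^sup>2" if "l \<in> R" for l
    using power_mono[OF Cm_bdd_Lipschitz[OF assms[OF that], of x y], of 2]
    by (simp add: power_mult_distrib)
  then have "(\<Sum>l\<in>R. (g l x - g l y)\<^sup>2) \<le> (\<Sum>l\<in>R. (real CARD('r) * B)\<^sup>2 * (norm (x - y))\<^sup>2)"
    by (rule sum_mono)
  then show ?thesis using False by (simp add: rho_sq_def field_simps)
qed (simp add: rho_sq_def)

text \<open>Half of the mean squared differential \<open>Q\<close> survives after subtracting the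
  squared Taylor error \<open>?T\<close>. The Gram bound gives
  \<open>Q \<ge> \<kappa> * (norm d)^2\<close>, and \<open>near\<close> says exactly that
  \<open>?T\<close> uses up at most a quarter of this, which leaves \<kappa>/4. The summand 1 in
  \<open>B^2 + 1\<close> keeps the denominator of \<kappa> positive when
  \<open>B = 0\<close>.\<close>

lemma rho_sq_local_lower:
  fixes g :: "nat \<Rightarrow> real^'r \<Rightarrow> real"
  assumes R: "finite R" "R \<noteq> {}" and m: "m \<ge> 2" and g: "\<And>l. l \<in> R \<Longrightarrow> Cm_bdd m B (g l)"
    and c: "c \<ge> 0" "s_min (\<chi> a b. (1 / real (card R)) * (\<Sum>l\<in>R. pderiv_at (g l) a x * pderiv_at (g l) b x)) \<ge> c"
    and K: "\<kappa> = c\<^sup>2 / (real CARD('r) * (B\<^sup>2 + 1))"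
    and near: "(real CARD('r))^4 * B\<^sup>2 * (norm (y - x))\<^sup>2 \<le> \<kappa> / 4"
  shows "\<kappa> / 4 * (norm (y - x))\<^sup>2 \<le> rho_sq R (\<lambda>l. g l x) (\<lambda>l. g l y)"
proof -
  obtain m' where m': "m = Suc m'" using m by (cases m) auto
  define d where "d = y - x"
  define q where "q l = frechet_derivative (g l) (at x) d" for l
  define Q where "Q = 1 / real (card R) * (\<Sum>l\<in>R. (q l)\<^sup>2)"
  have card: "real (card R) > 0" using R by (simp add: card_gt_0_iff)
  have Q0: "Q \<ge> 0" by (simp add: Q_def sum_nonneg)
  have qe: "q l = (\<Sum>b\<in>UNIV. pderiv_at (g l) b x * d $ b)" if "l \<in> R" for l
    using linear_axis_expand[OF has_derivative_linear[OF Cm_bdd_has_derivative[OF g[OF that, unfolded m']]], of x d]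
    by (simp add: q_def pderiv_at_def mult_ac)
  have "c\<^sup>2 * (norm d)\<^sup>2
     \<le> real CARD('r) * B\<^sup>2 * (1 / real (card R) * (\<Sum>l\<in>R. (\<Sum>b\<in>UNIV. pderiv_at (g l) b x * d $ b)\<^sup>2))"
    by (rule gram_quadratic_lower[OF R(1) _ c])
      (use Cm_bdd_partial[OF g[unfolded m']] in \<open>auto simp: pderiv_at_def\<close>)
  also have "\<dots> = real CARD('r) * B\<^sup>2 * Q"
    unfolding Q_def using qe by simp
  also have "\<dots> \<le> real CARD('r) * (B\<^sup>2 + 1) * Q"
    using Q0 by (intro mult_right_mono mult_left_mono) auto
  finally have kQ: "\<kappa> * (norm d)\<^sup>2 \<le> Q"
    unfolding K by (simp add: field_simps add_pos_nonneg pos_divide_le_eq)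
  let ?T = "(real CARD('r))^4 * B\<^sup>2 * (norm d)\<^sup>2 * (norm d)\<^sup>2"
  have *: "(q l)\<^sup>2 / 2 - ?T \<le> (g l x - g l y)\<^sup>2" if "l \<in> R" for l
  proof -
    have "\<bar>g l y - g l x - q l\<bar> \<le> (real CARD('r))\<^sup>2 * B * (norm d)\<^sup>2"
      using Cm_bdd_Taylor[OF g[OF that] m, of y x] by (simp add: q_def d_def)
    then have "(g l y - g l x - q l)\<^sup>2 \<le> ((real CARD('r))\<^sup>2 * B * (norm d)\<^sup>2)\<^sup>2"
      by (metis abs_ge_zero power2_abs power_mono)
    also have "\<dots> = ?T" by (simp add: power_mult_distrib power_mult[symmetric] power2_eq_square power4_eq_xxxx)
    finally have 1: "(g l y - g l x - q l)\<^sup>2 \<le> ?T" .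
    \<comment> \<open>With w = \<open>g l y - g l x\<close> this is (2w - q)^2 \<ge> 0
      rearranged.\<close>
    have "(q l)\<^sup>2 \<le> 2 * (g l x - g l y)\<^sup>2 + 2 * (g l y - g l x - q l)\<^sup>2"
      using sum_squares_ge_zero[of "2 * (g l y - g l x) - q l" 0]
      by (simp add: power2_eq_square algebra_simps)
    with 1 show ?thesis by linarith
  qed
  have "Q / 2 - ?T = 1 / real (card R) * (\<Sum>l\<in>R. ((q l)\<^sup>2 / 2 - ?T))"
    using card by (simp add: Q_def sum_subtractf sum_divide_distrib[symmetric] field_simps)
  also have "\<dots> \<le> 1 / real (card R) * (\<Sum>l\<in>R. (g l x - g l y)\<^sup>2)"
    by (intro mult_left_mono sum_mono *) auto
  also have "\<dots> = rho_sq R (\<lambda>l. g l x) (\<lambda>l. g l y)" by (simp add: rho_sq_def)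
  finally have "Q / 2 - ?T \<le> rho_sq R (\<lambda>l. g l x) (\<lambda>l. g l y)" .
  moreover have "?T \<le> \<kappa> / 4 * (norm d)\<^sup>2"
    using near unfolding d_def by (intro mult_right_mono) auto
  ultimately show ?thesis using kQ unfolding d_def by (simp add: field_simps)
qed

section \<open>Exponential bounds from conditional independence\<close>

lemma (in prob_space) integrable_AE_bounded:
  fixes f :: "'a \<Rightarrow> real"
  assumes "f \<in> borel_measurable M" "AE x in M. \<bar>f x\<bar> \<le> K"
  shows "integrable M f"
  using assms by (intro integrable_const_bound[of _ K]) auto

lemma AE_bounded_prod:
  fixes f :: "'i \<Rightarrow> 'a \<Rightarrow> real"
  assumes "finite I" "\<And>i. i \<in> I \<Longrightarrow> \<exists>K. AE x in M. \<bar>f i x\<bar> \<le> K"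
  shows "\<exists>K. AE x in M. \<bar>\<Prod>i\<in>I. f i x\<bar> \<le> K"
proof -
  have "\<forall>i\<in>I. \<exists>K. AE x in M. \<bar>f i x\<bar> \<le> K" using assms(2) by blast
  from bchoice[OF this] obtain K where K: "\<And>i. i \<in> I \<Longrightarrow> AE x in M. \<bar>f i x\<bar> \<le> K i" by blast
  have "AE x in M. \<forall>i\<in>I. \<bar>f i x\<bar> \<le> K i"
    using K assms(1) by (subst AE_finite_all) auto
  then have "AE x in M. \<bar>\<Prod>i\<in>I. f i x\<bar> \<le> (\<Prod>i\<in>I. K i)"
    by eventually_elim (auto simp: abs_prod intro!: prod_mono)
  then show ?thesis ..
qed

lemma AE_bounded_mult:
  fixes f g :: "'a \<Rightarrow> real"
  assumes "\<exists>K. AE x in M. \<bar>f x\<bar> \<le> K" "\<exists>K. AE x in M. \<bar>g x\<bar> \<le> K"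
  shows "\<exists>K. AE x in M. \<bar>f x * g x\<bar> \<le> K"
proof -
  obtain K K' where K: "AE x in M. \<bar>f x\<bar> \<le> K" and K': "AE x in M. \<bar>g x\<bar> \<le> K'" using assms by blast
  from K K' have "AE x in M. \<bar>f x * g x\<bar> \<le> K * K'"
  proof eventually_elim
    case (elim x)
    then show ?case using mult_mono[of "\<bar>f x\<bar>" K "\<bar>g x\<bar>" K'] by (auto simp: abs_mult)
  qed
  then show ?thesis ..
qed

lemma AE_bounded_real_cond_exp:
  fixes X :: "'a \<Rightarrow> real"
  assumes "prob_space M" "subalgebra M F" "X \<in> borel_measurable M" "\<And>x. \<bar>X x\<bar> \<le> B"
  shows "AE x in M. \<bar>real_cond_exp M F X x\<bar> \<le> B"
proof -
  interpret prob_space M by fact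
  interpret finite_measure_subalgebra M F by unfold_locales (fact assms(2))
  have int: "integrable M X" using assms by (intro integrable_AE_bounded[of _ B]) auto
  have "AE x in M. X x \<ge> - B" "AE x in M. X x \<le> B"
    using assms(4) by (auto intro!: AE_I2 simp: abs_le_iff minus_le_iff)
  with real_cond_exp_ge_c[OF int, of "-B"] real_cond_exp_le_c[OF int, of B]
  have "AE x in M. real_cond_exp M F X x \<ge> - B" "AE x in M. real_cond_exp M F X x \<le> B" by auto
  then show ?thesis by eventually_elim auto
qed

text \<open>Because (1 + y + y^2)(1 - y) = 1 - y^3 \<ge> 1 for y \<le> 0, and exp(-y) \<ge> 1 - y.
  Arguments in [0, 1] are handled by \<open>exp_bound\<close>, so the quadratic bound is available
  for every y \<le> 1.\<close>

lemma exp_neg_le_quadratic: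
  fixes y :: real
  assumes "y \<le> 0"
  shows "exp y \<le> 1 + y + y\<^sup>2"
proof -
  have "1 \<le> (1 + y + y\<^sup>2) * (1 - y)"
    using assms by (simp add: power2_eq_square algebra_simps mult_nonneg_nonpos2 mult_nonpos_nonpos)
  also have "\<dots> \<le> (1 + y + y\<^sup>2) * exp (- y)"
    using exp_ge_add_one_self[of "-y"] zero_le_power2[of "y + 1/2"]
    by (intro mult_left_mono) (auto simp: power2_eq_square algebra_simps)
  finally show ?thesis by (simp add: exp_minus field_simps)
qed

locale noise_family = prob_space M + finite_measure_subalgebra M F
  for M F :: "'a measure" +
  fixes u :: "nat \<Rightarrow> nat \<Rightarrow> 'a \<Rightarrow> real" and N P :: nat
  assumes u_meas: "\<And>i l. i < N \<Longrightarrow> l < P \<Longrightarrow> u i l \<in> borel_measurable M"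
    and u_indep: "cond_indep_vars M F (\<lambda>il. u (fst il) (snd il)) ({..<N} \<times> {..<P})"
begin

text \<open>Conditional independence is only available for products of functions of single noise
  variables. A product over rows of polynomials in the pair \<open>(u i l, u j l)\<close> expands into such
  products, so no extension to joint functions of the pair is needed.\<close>

lemma integral_prod_monomial:
  fixes g h :: "nat \<Rightarrow> real \<Rightarrow> real"
  assumes ij: "i < N" "j < N" "i \<noteq> j" and R: "R \<subseteq> {..<P}"
    and g: "\<And>l. l \<in> R \<Longrightarrow> g l \<in> borel_measurable borel" "\<And>l. l \<in> R \<Longrightarrow> \<exists>B. \<forall>x. \<bar>g l x\<bar> \<le> B"
    and h: "\<And>l. l \<in> R \<Longrightarrow> h l \<in> borel_measurable borel" "\<And>l. l \<in> R \<Longrightarrow> \<exists>B. \<forall>x. \<bar>h l x\<bar> \<le> B"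
    and D: "D \<in> borel_measurable F" "\<exists>K. AE x in M. \<bar>D x\<bar> \<le> K"
  shows "integrable M (\<lambda>x. D x * (\<Prod>l\<in>R. g l (u i l x) * h l (u j l x)))"
    and "integrable M (\<lambda>x. D x * (\<Prod>l\<in>R. real_cond_exp M F (\<lambda>x. g l (u i l x)) x
              * real_cond_exp M F (\<lambda>x. h l (u j l x)) x))"
    and "(\<integral>x. D x * (\<Prod>l\<in>R. g l (u i l x) * h l (u j l x)) \<partial>M)
        = (\<integral>x. D x * (\<Prod>l\<in>R. real_cond_exp M F (\<lambda>x. g l (u i l x)) x
              * real_cond_exp M F (\<lambda>x. h l (u j l x)) x) \<partial>M)"
proof -
  have finR: "finite R" using R finite_subset by blast
  \<comment> \<open>Both columns are put into one index set, so that conditional independence is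
    invoked once for all factors. The two blocks are disjoint because
    \<open>i \<noteq> j\<close>.\<close>
  define J where "J = {i} \<times> R \<union> {j} \<times> R"
  define G where "G il = (if fst il = i then g (snd il) else h (snd il))" for il
  have disj: "({i} \<times> R) \<inter> ({j} \<times> R) = {}" using ij by auto
  have split: "(\<Prod>il\<in>J. \<phi> il) = (\<Prod>l\<in>R. \<phi> (i, l) * \<phi> (j, l))" for \<phi> :: "nat \<times> nat \<Rightarrow> real"
  proof -
    have img: "{a} \<times> R = Pair a ` R" for a :: nat by auto
    have "(\<Prod>il\<in>J. \<phi> il) = (\<Prod>il\<in>{i} \<times> R. \<phi> il) * (\<Prod>il\<in>{j} \<times> R. \<phi> il)"
      unfolding J_def by (rule prod.union_disjoint) (use finR disj in auto)
    also have "\<dots> = (\<Prod>l\<in>R. \<phi> (i, l)) * (\<Prod>l\<in>R. \<phi> (j, l))"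
      unfolding img by (subst (1 2) prod.reindex) (auto simp: inj_on_def)
    finally show ?thesis by (simp add: prod.distrib)
  qed
  have G: "G il \<in> borel_measurable borel" "\<exists>B. \<forall>x. \<bar>G il x\<bar> \<le> B" if "il \<in> J" for il
    using that g h unfolding J_def G_def by auto
  have J: "finite J" "J \<subseteq> {..<N} \<times> {..<P}" using finR ij R by (auto simp: J_def)
  have umJ: "u (fst il) (snd il) \<in> borel_measurable M" if "il \<in> J" for il
    using that J u_meas[of "fst il" "snd il"] by (cases il) auto
  let ?X = "\<lambda>x. \<Prod>il\<in>J. G il (u (fst il) (snd il) x)"
  let ?E = "\<lambda>x. \<Prod>il\<in>J. real_cond_exp M F (\<lambda>x. G il (u (fst il) (snd il) x)) x"
  have E: "AE x in M. real_cond_exp M F ?X x = ?E x"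
    using u_indep[unfolded cond_indep_vars_def, rule_format, of J G] J G by simp
  have mX: "?X \<in> borel_measurable M"
    by (intro borel_measurable_prod measurable_compose[OF umJ G(1)])
  have D': "D \<in> borel_measurable M" by (rule measurable_from_subalg[OF subalg D(1)])
  have "\<exists>K. AE x in M. \<bar>?X x\<bar> \<le> K"
    by (intro AE_bounded_prod J) (metis (mono_tags, lifting) AE_I2 G(2))
  then obtain K where "AE x in M. \<bar>D x * ?X x\<bar> \<le> K" using AE_bounded_mult[OF D(2), of ?X] by blast
  \<comment> \<open>Integrability is all that is needed to replace \<open>?X\<close> by its
    conditional expectation under an integral with the F-measurable weight \<open>D\<close>. The
    factorization therefore holds in integrated form, which suffices for probabilities.\<close>
  then have int: "integrable M (\<lambda>x. D x * ?X x)"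
    using D' mX by (intro integrable_AE_bounded) auto
  have AEe: "AE x in M. D x * real_cond_exp M F ?X x = D x * ?E x"
    using E by eventually_elim simp
  have mE: "(\<lambda>x. D x * ?E x) \<in> borel_measurable M" using D' by measurable
  have mR: "(\<lambda>x. D x * real_cond_exp M F ?X x) \<in> borel_measurable M" using D' by measurable
  have intE: "integrable M (\<lambda>x. D x * ?E x)"
    using real_cond_exp_intg(1)[OF int D(1) mX] integrable_cong_AE[OF mR mE AEe] by blast
  have eq: "(\<integral>x. D x * ?X x \<partial>M) = (\<integral>x. D x * ?E x \<partial>M)"
    using real_cond_exp_intg(2)[OF int D(1) mX] integral_cong_AE[OF mR mE AEe] by simp
  have [simp]: "G (i, l) = g l" "G (j, l) = h l" for l using ij by (auto simp: G_def)
  note rw = split[of "\<lambda>il. G il (u (fst il) (snd il) x)" for x, simplified]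
     split[of "\<lambda>il. real_cond_exp M F (\<lambda>x. G il (u (fst il) (snd il) x)) x" for x, simplified]
  show "integrable M (\<lambda>x. D x * (\<Prod>l\<in>R. g l (u i l x) * h l (u j l x)))"
    using int unfolding rw .
  show "integrable M (\<lambda>x. D x * (\<Prod>l\<in>R. real_cond_exp M F (\<lambda>x. g l (u i l x)) x
              * real_cond_exp M F (\<lambda>x. h l (u j l x)) x))"
    using intE unfolding rw .
  show "(\<integral>x. D x * (\<Prod>l\<in>R. g l (u i l x) * h l (u j l x)) \<partial>M)
        = (\<integral>x. D x * (\<Prod>l\<in>R. real_cond_exp M F (\<lambda>x. g l (u i l x)) x
              * real_cond_exp M F (\<lambda>x. h l (u j l x)) x) \<partial>M)"
    using eq unfolding rw .
qed

text \<open>Expanding the product of sums gives one monomial for each choice function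
  \<open>s\<close> in \<open>PiE R (\<lambda>_. S)\<close>. Its coefficients are F-measurable and
  join the weight as \<open>Ds s\<close>, so the monomial case applies, and the same expansion read
  backwards reassembles the product.\<close>

lemma integral_prod_polynomial:
  fixes g h :: "'s \<Rightarrow> real \<Rightarrow> real" and c :: "'s \<Rightarrow> nat \<Rightarrow> 'a \<Rightarrow> real"
  assumes ij: "i < N" "j < N" "i \<noteq> j" and R: "R \<subseteq> {..<P}" and S: "finite S"
    and g: "\<And>s. s \<in> S \<Longrightarrow> g s \<in> borel_measurable borel" "\<And>s. s \<in> S \<Longrightarrow> \<exists>B. \<forall>x. \<bar>g s x\<bar> \<le> B"
    and h: "\<And>s. s \<in> S \<Longrightarrow> h s \<in> borel_measurable borel" "\<And>s. s \<in> S \<Longrightarrow> \<exists>B. \<forall>x. \<bar>h s x\<bar> \<le> B"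
    and c: "\<And>s l. s \<in> S \<Longrightarrow> l \<in> R \<Longrightarrow> c s l \<in> borel_measurable F"
       "\<And>s l. s \<in> S \<Longrightarrow> l \<in> R \<Longrightarrow> \<exists>B. AE x in M. \<bar>c s l x\<bar> \<le> B"
    and D: "D \<in> borel_measurable F" "\<exists>K. AE x in M. \<bar>D x\<bar> \<le> K"
  shows "integrable M (\<lambda>x. D x * (\<Prod>l\<in>R. \<Sum>s\<in>S. c s l x * (g s (u i l x) * h s (u j l x))))"
    and "integrable M (\<lambda>x. D x * (\<Prod>l\<in>R. \<Sum>s\<in>S. c s l x * (real_cond_exp M F (\<lambda>x. g s (u i l x)) x
              * real_cond_exp M F (\<lambda>x. h s (u j l x)) x)))"
    and "(\<integral>x. D x * (\<Prod>l\<in>R. \<Sum>s\<in>S. c s l x * (g s (u i l x) * h s (u j l x))) \<partial>M)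
        = (\<integral>x. D x * (\<Prod>l\<in>R. \<Sum>s\<in>S. c s l x * (real_cond_exp M F (\<lambda>x. g s (u i l x)) x
              * real_cond_exp M F (\<lambda>x. h s (u j l x)) x)) \<partial>M)"
proof -
  have finR: "finite R" using R finite_subset by blast
  define Ds where "Ds s x = D x * (\<Prod>l\<in>R. c (s l) l x)" for s and x
  have expand: "D x * (\<Prod>l\<in>R. \<Sum>s\<in>S. c s l x * \<phi> s l) = (\<Sum>s\<in>PiE R (\<lambda>_. S). Ds s x * (\<Prod>l\<in>R. \<phi> (s l) l))"
    for x and \<phi> :: "'s \<Rightarrow> nat \<Rightarrow> real"
    by (subst prod_sum_PiE[OF finR S]) (simp add: prod.distrib sum_distrib_left Ds_def mult_ac)
  have Ds: "Ds s \<in> borel_measurable F" "\<exists>K. AE x in M. \<bar>Ds s x\<bar> \<le> K" if s: "s \<in> PiE R (\<lambda>_. S)" for s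
  proof -
    have sl: "s l \<in> S" if "l \<in> R" for l using s that by auto
    show "Ds s \<in> borel_measurable F"
      unfolding Ds_def using D(1) c(1) sl by (intro borel_measurable_times borel_measurable_prod) auto
    show "\<exists>K. AE x in M. \<bar>Ds s x\<bar> \<le> K"
      unfolding Ds_def using c(2) sl by (intro AE_bounded_mult AE_bounded_prod D finR) auto
  qed
  have mono: "integrable M (\<lambda>x. Ds s x * (\<Prod>l\<in>R. g (s l) (u i l x) * h (s l) (u j l x)))"
    "integrable M (\<lambda>x. Ds s x * (\<Prod>l\<in>R. real_cond_exp M F (\<lambda>x. g (s l) (u i l x)) x
              * real_cond_exp M F (\<lambda>x. h (s l) (u j l x)) x))"
    "(\<integral>x. Ds s x * (\<Prod>l\<in>R. g (s l) (u i l x) * h (s l) (u j l x)) \<partial>M)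
        = (\<integral>x. Ds s x * (\<Prod>l\<in>R. real_cond_exp M F (\<lambda>x. g (s l) (u i l x)) x
              * real_cond_exp M F (\<lambda>x. h (s l) (u j l x)) x) \<partial>M)"
    if s: "s \<in> PiE R (\<lambda>_. S)" for s
  proof -
    have sl: "s l \<in> S" if "l \<in> R" for l using s that by auto
    note * = integral_prod_monomial[OF ij R, where g = "\<lambda>l. g (s l)" and h = "\<lambda>l. h (s l)" and D = "Ds s",
        OF g(1)[OF sl] g(2)[OF sl] h(1)[OF sl] h(2)[OF sl] Ds[OF s]]
    show "integrable M (\<lambda>x. Ds s x * (\<Prod>l\<in>R. g (s l) (u i l x) * h (s l) (u j l x)))"
      by (rule *(1))
    show "integrable M (\<lambda>x. Ds s x * (\<Prod>l\<in>R. real_cond_exp M F (\<lambda>x. g (s l) (u i l x)) x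
              * real_cond_exp M F (\<lambda>x. h (s l) (u j l x)) x))"
      by (rule *(2))
    show "(\<integral>x. Ds s x * (\<Prod>l\<in>R. g (s l) (u i l x) * h (s l) (u j l x)) \<partial>M)
        = (\<integral>x. Ds s x * (\<Prod>l\<in>R. real_cond_exp M F (\<lambda>x. g (s l) (u i l x)) x
              * real_cond_exp M F (\<lambda>x. h (s l) (u j l x)) x) \<partial>M)"
      by (rule *(3))
  qed
  show "integrable M (\<lambda>x. D x * (\<Prod>l\<in>R. \<Sum>s\<in>S. c s l x * (g s (u i l x) * h s (u j l x))))"
    unfolding expand by (intro Bochner_Integration.integrable_sum mono)
  show "integrable M (\<lambda>x. D x * (\<Prod>l\<in>R. \<Sum>s\<in>S. c s l x * (real_cond_exp M F (\<lambda>x. g s (u i l x)) x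
              * real_cond_exp M F (\<lambda>x. h s (u j l x)) x)))"
    unfolding expand by (intro Bochner_Integration.integrable_sum mono)
  show "(\<integral>x. D x * (\<Prod>l\<in>R. \<Sum>s\<in>S. c s l x * (g s (u i l x) * h s (u j l x))) \<partial>M)
        = (\<integral>x. D x * (\<Prod>l\<in>R. \<Sum>s\<in>S. c s l x * (real_cond_exp M F (\<lambda>x. g s (u i l x)) x
              * real_cond_exp M F (\<lambda>x. h s (u j l x)) x)) \<partial>M)"
    unfolding expand by (simp add: Bochner_Integration.integral_sum mono)
qed

text \<open>The bound \<open>exp y \<le> 1 + y + y\<^sup>2\<close> for \<open>y \<le> 1\<close> replaces the exponential moment, which does not
  factor over \<open>u i l\<close> and \<open>u j l\<close>, by a polynomial one. The centring by the conditional mean is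
  part of the \<open>F\<close>-measurable weight \<open>D\<close>.\<close>

lemma conditional_Chernoff:
  fixes g h :: "real \<Rightarrow> real" and c :: "nat \<Rightarrow> 'a \<Rightarrow> real"
  defines "Eg \<equiv> \<lambda>s l x. real_cond_exp M F (\<lambda>x. g (u s l x)) x"
    and "Eh \<equiv> \<lambda>s l x. real_cond_exp M F (\<lambda>x. h (u s l x)) x"
    and "Eg2 \<equiv> \<lambda>s l x. real_cond_exp M F (\<lambda>x. (g (u s l x))\<^sup>2) x"
    and "Eh2 \<equiv> \<lambda>s l x. real_cond_exp M F (\<lambda>x. (h (u s l x))\<^sup>2) x"
  assumes ij: "i < N" "j < N" "i \<noteq> j" and R: "R \<subseteq> {..<P}"
    and g: "g \<in> borel_measurable borel" "\<And>x. \<bar>g x\<bar> \<le> Bg"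
    and h: "h \<in> borel_measurable borel" "\<And>x. \<bar>h x\<bar> \<le> Bh"
    and c: "\<And>l. l \<in> R \<Longrightarrow> c l \<in> borel_measurable F" "\<And>l x. l \<in> R \<Longrightarrow> x \<in> space M \<Longrightarrow> \<bar>c l x\<bar> \<le> Bc"
    and lam: "lam \<ge> 0" "lam * (Bc * (Bg * Bh)) \<le> 1"
    and G: "G \<in> sets F"
    and V: "AE x in M. x \<in> G \<longrightarrow> (\<forall>l\<in>R. (c l x)\<^sup>2 * (Eg2 i l x * Eh2 j l x) \<le> V)"
  shows "measure M {x \<in> G. (\<Sum>l\<in>R. c l x * (g (u i l x) * h (u j l x)))
                \<ge> (\<Sum>l\<in>R. c l x * (Eg i l x * Eh j l x)) + t}
      \<le> exp (lam\<^sup>2 * (real (card R) * V) - lam * t)"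
proof -
  have finR: "finite R" using R finite_subset by blast
  have Bg0: "Bg \<ge> 0" using g(2)[of 0] by linarith
  have Bh0: "Bh \<ge> 0" using h(2)[of 0] by linarith
  have um: "u i l \<in> borel_measurable M" "u j l \<in> borel_measurable M" if "l \<in> R" for l
    using that R u_meas ij by auto
  have [measurable]: "G \<in> sets M" using G subalg by (auto simp: subalgebra_def)
  have cm: "c l \<in> borel_measurable M" if "l \<in> R" for l
    by (rule measurable_from_subalg[OF subalg c(1)[OF that]])
  define W where "W l x = c l x * (g (u i l x) * h (u j l x))" for l x
  define mm where "mm l x = c l x * (Eg i l x * Eh j l x)" for l x
  define ss where "ss l x = (c l x)\<^sup>2 * (Eg2 i l x * Eh2 j l x)" for l x
  have Wm: "W l \<in> borel_measurable M" if "l \<in> R" for l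
    unfolding W_def using cm[OF that] measurable_compose[OF um(1)[OF that] g(1)]
      measurable_compose[OF um(2)[OF that] h(1)] by measurable
  have mmF: "mm l \<in> borel_measurable F" if "l \<in> R" for l
    unfolding mm_def Eg_def Eh_def using c(1)[OF that] by measurable
  have Wb: "lam * W l x \<le> 1" "- 1 \<le> lam * W l x" if "l \<in> R" "x \<in> space M" for l x
  proof -
    have "\<bar>W l x\<bar> \<le> Bc * (Bg * Bh)" unfolding W_def abs_mult
      using c(2)[OF that] g h Bg0 Bh0 by (intro mult_mono) auto
    then have "lam * \<bar>W l x\<bar> \<le> 1" using lam mult_left_mono order_trans by blast
    then have "\<bar>lam * W l x\<bar> \<le> 1" using lam by (simp add: abs_mult)
    then show "lam * W l x \<le> 1" "- 1 \<le> lam * W l x" by auto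
  qed
  have AEg: "AE x in M. \<forall>l\<in>R. \<bar>Eg i l x\<bar> \<le> Bg" "AE x in M. \<forall>l\<in>R. \<bar>Eh j l x\<bar> \<le> Bh"
    unfolding Eg_def Eh_def using finR um g h
    by (auto simp: AE_finite_all intro!: AE_bounded_real_cond_exp prob_space_axioms subalg
         measurable_compose[OF _ g(1)] measurable_compose[OF _ h(1)])
  have AE2: "AE x in M. \<forall>l\<in>R. 0 \<le> Eg2 i l x" "AE x in M. \<forall>l\<in>R. 0 \<le> Eh2 j l x"
    unfolding Eg2_def Eh2_def using finR um g h
    by (auto simp: AE_finite_all intro!: real_cond_exp_pos borel_measurable_power
         measurable_compose[OF _ g(1)] measurable_compose[OF _ h(1)])
  have AEm: "AE x in M. \<forall>l\<in>R. \<bar>mm l x\<bar> \<le> Bc * (Bg * Bh)"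
    using AEg AE_space
  proof eventually_elim
    case (elim x)
    show ?case
    proof
      fix l assume l: "l \<in> R"
      show "\<bar>mm l x\<bar> \<le> Bc * (Bg * Bh)" unfolding mm_def abs_mult
        using c(2)[OF l, of x] elim l Bg0 Bh0 by (intro mult_mono) auto
    qed
  qed
  \<comment> \<open>The restriction to \<open>G\<close> is part of the weight because the variance
    bound \<open>V\<close> is only assumed there; off \<open>G\<close> both integrands
    vanish.\<close>
  define D where "D x = indicator G x * exp (- lam * (\<Sum>l\<in>R. mm l x) - lam * t)" for x
  have D0: "D x \<ge> 0" for x by (simp add: D_def)
  have DF: "D \<in> borel_measurable F"
  proof -
    have "(\<lambda>x. \<Sum>l\<in>R. mm l x) \<in> borel_measurable F" using mmF by measurable
    then show ?thesis unfolding D_def using G by measurable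
  qed
  have Db: "\<exists>K. AE x in M. \<bar>D x\<bar> \<le> K"
  proof (rule exI)
    show "AE x in M. \<bar>D x\<bar> \<le> exp (\<bar>lam\<bar> * (\<Sum>l\<in>R. Bc * (Bg * Bh)) - lam * t)"
      using AEm
    proof eventually_elim
      case (elim x)
      have "\<bar>\<Sum>l\<in>R. mm l x\<bar> \<le> (\<Sum>l\<in>R. Bc * (Bg * Bh))"
        using elim by (intro order_trans[OF sum_abs] sum_mono) auto
      then have "- lam * (\<Sum>l\<in>R. mm l x) \<le> \<bar>lam\<bar> * (\<Sum>l\<in>R. Bc * (Bg * Bh))"
        using abs_ge_self[of "- lam * (\<Sum>l\<in>R. mm l x)"] mult_left_mono[OF _ abs_ge_zero, of "\<bar>\<Sum>l\<in>R. mm l x\<bar>" _ lam]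
        by (fastforce simp: abs_mult)
      then show ?case by (auto simp: D_def indicator_def)
    qed
  qed
  \<comment> \<open>Coefficients of 1 + y + y^2 with y = \<open>lam * W l x\<close>, read as a
    polynomial in \<open>g (u i l x) * h (u j l x)\<close>: the exponent \<open>s\<close> ranges
    over 0, 1, 2.\<close>
  define cc where "cc s l x = (if s = (0::nat) then 1 else if s = 1 then lam * c l x else lam\<^sup>2 * (c l x)\<^sup>2)" for s l x
  have three: "{..<3::nat} = {0,1,2}" by auto
  have cc: "cc s l \<in> borel_measurable F" "\<exists>B. AE x in M. \<bar>cc s l x\<bar> \<le> B" if "l \<in> R" for s l
  proof -
    show "cc s l \<in> borel_measurable F" unfolding cc_def using c(1)[OF that] by measurable
    have "AE x in M. \<bar>c l x\<bar> \<le> Bc" using c(2)[OF that] by (intro AE_I2) 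
    then have "AE x in M. \<bar>cc s l x\<bar> \<le> 1 + lam * Bc + lam\<^sup>2 * Bc\<^sup>2"
    proof eventually_elim
      case (elim x)
      then have "(c l x)\<^sup>2 \<le> Bc\<^sup>2" by (metis abs_ge_zero power2_abs power_mono)
      moreover have "Bc \<ge> 0" using elim by linarith
      ultimately show ?case
        using elim lam(1) mult_left_mono[OF elim lam(1)] mult_left_mono[of "(c l x)\<^sup>2" "Bc\<^sup>2" "lam\<^sup>2"]
        by (auto simp: cc_def abs_mult add_nonneg_nonneg intro: add_increasing add_increasing2)
    qed
    then show "\<exists>B. AE x in M. \<bar>cc s l x\<bar> \<le> B" ..
  qed
  have pw: "\<bar>a ^ s\<bar> \<le> (b + 1) ^ 2" if "s < (3::nat)" "\<bar>a\<bar> \<le> b" for a b :: real and s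
  proof -
    have "\<bar>a ^ s\<bar> = \<bar>a\<bar> ^ s" by (simp add: power_abs)
    also have "\<dots> \<le> (b + 1) ^ s" using that by (intro power_mono) auto
    also have "\<dots> \<le> (b + 1) ^ 2" using that by (intro power_increasing) auto
    finally show ?thesis .
  qed
  have gp: "(\<lambda>x. g x ^ s) \<in> borel_measurable borel" "(\<lambda>x. h x ^ s) \<in> borel_measurable borel" for s
    using g(1) h(1) by (simp_all add: borel_measurable_power)
  have gb: "\<exists>B. \<forall>x. \<bar>g x ^ s\<bar> \<le> B" "\<exists>B. \<forall>x. \<bar>h x ^ s\<bar> \<le> B" if "s \<in> {..<3}" for s
    using that pw[OF _ g(2)] pw[OF _ h(2)] by blast+
  note poly = integral_prod_polynomial[OF ij R, where g = "\<lambda>s x. g x ^ s" and h = "\<lambda>s x. h x ^ s"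
      and D = D and S = "{..<3}" and c = cc, OF finite_lessThan gp(1) gb(1) gp(2) gb(2) cc DF Db]
  have one: "AE x in M. real_cond_exp M F (\<lambda>_. 1) x = 1" by (rule real_cond_exp_F_meas) auto
  have A1: "(\<Sum>s<3. cc s l x * ((g (u i l x)) ^ s * (h (u j l x)) ^ s)) = 1 + lam * W l x + (lam * W l x)\<^sup>2" for l x
    by (simp add: three cc_def W_def power_mult_distrib)
  let ?Y = "\<lambda>x. D x * (\<Prod>l\<in>R. 1 + lam * W l x + (lam * W l x)\<^sup>2)"
  let ?Z = "\<lambda>x. D x * (\<Prod>l\<in>R. \<Sum>s<3. cc s l x * (real_cond_exp M F (\<lambda>x. (g (u i l x)) ^ s) x
              * real_cond_exp M F (\<lambda>x. (h (u j l x)) ^ s) x))"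
  have intY: "integrable M ?Y" and YZ: "(\<integral>x. ?Y x \<partial>M) = (\<integral>x. ?Z x \<partial>M)"
    using poly(1,3) unfolding A1 by simp_all
  let ?A = "{x \<in> G. (\<Sum>l\<in>R. W l x) \<ge> (\<Sum>l\<in>R. mm l x) + t}"
  have Am: "?A \<in> sets M"
  proof -
    have "(\<lambda>x. \<Sum>l\<in>R. mm l x) \<in> borel_measurable M" 
      using measurable_from_subalg[OF subalg mmF] by measurable
    moreover have "(\<lambda>x. \<Sum>l\<in>R. W l x) \<in> borel_measurable M" using Wm by measurable
    ultimately show ?thesis by measurable
  qed
  have "measure M ?A = (\<integral>x. indicator ?A x \<partial>M)" using Am by (simp add: sets.sets_into_space Int_absorb2)
  also have "\<dots> \<le> (\<integral>x. ?Y x \<partial>M)"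
  proof (rule integral_mono[OF _ intY])
    show "integrable M (indicator ?A :: 'a \<Rightarrow> real)" using Am by (simp add: emeasure_eq_measure)
    fix x assume x: "x \<in> space M"
    \<comment> \<open>Markov's inequality in pointwise form: on \<open>?A\<close> the exponent of
      the right-hand side is nonnegative, elsewhere the right-hand side is nonnegative.\<close>
    have "indicator ?A x \<le> D x * (\<Prod>l\<in>R. exp (lam * W l x))"
    proof (cases "x \<in> ?A")
      case True
      then have "lam * ((\<Sum>l\<in>R. mm l x) + t) \<le> lam * (\<Sum>l\<in>R. W l x)"
        using lam by (intro mult_left_mono) auto
      then have "1 \<le> exp (- lam * (\<Sum>l\<in>R. mm l x) - lam * t + lam * (\<Sum>l\<in>R. W l x))"
        by (simp add: algebra_simps)
      then show ?thesis using True finR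
        by (simp add: D_def exp_sum[symmetric] sum_distrib_left exp_add[symmetric])
    qed (simp add: D0 prod_nonneg)
    also have "\<dots> \<le> ?Y x"
    proof (intro mult_left_mono prod_mono conjI D0)
      fix l assume l: "l \<in> R"
      show "exp (lam * W l x) \<le> 1 + lam * W l x + (lam * W l x)\<^sup>2"
      proof (cases "lam * W l x \<ge> 0")
        case True
        then show ?thesis using exp_bound Wb[OF l x] by auto
      next
        case False
        then show ?thesis by (intro exp_neg_le_quadratic) auto
      qed
    qed simp
    finally show "indicator ?A x \<le> ?Y x" .
  qed
  also have "\<dots> = (\<integral>x. ?Z x \<partial>M)" by (rule YZ)
  also have "\<dots> \<le> (\<integral>x. exp (lam\<^sup>2 * (real (card R) * V) - lam * t) \<partial>M)"
  proof (rule integral_mono_AE[OF poly(2)])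
    show "AE x in M. ?Z x \<le> exp (lam\<^sup>2 * (real (card R) * V) - lam * t)"
      using AE_space one V AEm AE2
    proof eventually_elim
      case (elim x)
      have e: "(\<Sum>s<3. cc s l x * (real_cond_exp M F (\<lambda>x. (g (u i l x)) ^ s) x
              * real_cond_exp M F (\<lambda>x. (h (u j l x)) ^ s) x)) = 1 + lam * mm l x + lam\<^sup>2 * ss l x" for l
        using elim(2) by (simp add: three cc_def mm_def ss_def Eg_def Eh_def Eg2_def Eh2_def)
      show ?case
      proof (cases "x \<in> G")
        case True
        \<comment> \<open>Comparing products factor by factor requires nonnegative factors; this
          follows from \<open>lam * \<bar>mm l x\<bar> \<le> 1\<close>. The upper bound is 1 + z
          \<le> exp z, and the resulting \<open>exp (lam * mm l x)\<close> cancel against the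
          centring in \<open>D\<close>.\<close>
        have f: "0 \<le> 1 + lam * mm l x + lam\<^sup>2 * ss l x \<and>
            1 + lam * mm l x + lam\<^sup>2 * ss l x \<le> exp (lam * mm l x) * exp (lam\<^sup>2 * V)" if l: "l \<in> R" for l
        proof
          have "lam * \<bar>mm l x\<bar> \<le> 1"
            using elim(4) l lam mult_left_mono order_trans by blast
          then have "- 1 \<le> lam * mm l x"
            using lam by (metis abs_le_iff abs_mult abs_of_nonneg minus_le_iff)
          moreover have "0 \<le> ss l x" using elim l by (simp add: ss_def)
          ultimately show "0 \<le> 1 + lam * mm l x + lam\<^sup>2 * ss l x"
            by (metis add.commute add_nonneg_nonneg mult_nonneg_nonneg neg_le_iff_le zero_le_power2 add_increasing2 diff_ge_0_iff_ge diff_minus_eq_add)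
          have "ss l x \<le> V" using elim True l by (simp add: ss_def)
          then have "1 + lam * mm l x + lam\<^sup>2 * ss l x \<le> 1 + (lam * mm l x + lam\<^sup>2 * V)"
            by (simp add: mult_left_mono)
          also have "\<dots> \<le> exp (lam * mm l x + lam\<^sup>2 * V)" by (rule exp_ge_add_one_self)
          finally show "1 + lam * mm l x + lam\<^sup>2 * ss l x \<le> exp (lam * mm l x) * exp (lam\<^sup>2 * V)"
            by (simp add: exp_add)
        qed
        have "?Z x \<le> D x * (\<Prod>l\<in>R. exp (lam * mm l x) * exp (lam\<^sup>2 * V))"
          unfolding e by (intro mult_left_mono prod_mono f D0)
        also have "\<dots> = exp (lam\<^sup>2 * (real (card R) * V) - lam * t)"
          using True finR
          by (simp add: D_def exp_sum[symmetric] exp_add[symmetric] sum.distrib sum_distrib_left[symmetric] mult_ac)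
        finally show ?thesis .
      qed (simp add: D_def)
    qed
  qed auto
  also have "\<dots> = exp (lam\<^sup>2 * (real (card R) * V) - lam * t)" by (simp add: prob_space)
  finally show ?thesis unfolding W_def mm_def .
qed

end

section \<open>Conditional moments of the truncated noise\<close>

text \<open>Finiteness of \<open>b\<close> matters, since \<open>enn2real\<close> sends infinity to
  0.\<close>

lemma enn2real_le_add:
  assumes "a \<le> b + ennreal d" "b < \<infinity>" "d \<ge> 0"
  shows "enn2real a \<le> enn2real b + d"
proof -
  have "enn2real a \<le> enn2real (b + ennreal d)"
    using assms by (intro enn2real_mono) (auto simp: ennreal_add_less_top less_top[symmetric])
  also have "\<dots> = enn2real b + d"
    using assms by (simp add: enn2real_plus)
  finally show ?thesis .
qed

text \<open>All truncation estimates come from this: \<open>a = 1\<close> controls the bias of the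
  mean, \<open>a = 2\<close> that of the second moment, and \<open>a = 0\<close> the probability of
  exceeding \<tau>.\<close>

lemma powr_tail_bound:
  fixes x \<tau> a q :: real
  assumes "\<tau> > 0" "\<bar>x\<bar> > \<tau>" "a \<le> q"
  shows "\<bar>x\<bar> powr a \<le> \<tau> powr (a - q) * \<bar>x\<bar> powr q"
proof -
  have "\<bar>x\<bar> powr (a - q) \<le> \<tau> powr (a - q)"
    using assms by (intro powr_mono2') auto
  then have "\<bar>x\<bar> powr (a - q) * \<bar>x\<bar> powr q \<le> \<tau> powr (a - q) * \<bar>x\<bar> powr q"
    by (intro mult_right_mono) auto
  then show ?thesis by (simp add: powr_add[symmetric])
qed

text \<open>Large values are set to 0 instead of being clipped at the level. Then \<open>x\<close>
  splits into two parts of which one is always 0, so the squares of \<open>trunc \<tau> x\<close>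
  and of the remainder add up to the square of \<open>x\<close>.\<close>

definition trunc :: "real \<Rightarrow> real \<Rightarrow> real" where
  "trunc \<tau> x = (if \<bar>x\<bar> \<le> \<tau> then x else 0)"

lemma trunc_measurable [measurable]: "trunc \<tau> \<in> borel_measurable borel"
  unfolding trunc_def by measurable

lemma abs_trunc_le: "\<tau> \<ge> 0 \<Longrightarrow> \<bar>trunc \<tau> x\<bar> \<le> \<tau>"
  by (auto simp: trunc_def)

lemma power_le_one_plus_powr:
  fixes x q :: real
  assumes "real s \<le> q" "s > 0"
  shows "\<bar>x\<bar> ^ s \<le> 1 + \<bar>x\<bar> powr q"
proof (cases "\<bar>x\<bar> \<le> 1")
  case True
  then have "\<bar>x\<bar> ^ s \<le> 1" by (simp add: power_le_one)
  then show ?thesis by (simp add: add_increasing2)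
next
  case False
  then have "\<bar>x\<bar> ^ s = \<bar>x\<bar> powr real s" by (simp add: powr_realpow)
  also have "\<dots> \<le> \<bar>x\<bar> powr q" using False assms by (intro powr_mono) auto
  finally show ?thesis by simp
qed

text \<open>The exponent \<open>q\<close> is later 4 + 2\<nu>; here \<open>q \<ge> 4\<close> makes
  the fourth moment, hence the variance of the squared noise, available. No moment bound is imposed
  almost surely: \<open>K\<close> acts only through the event defined next.\<close>

locale noise_moments = noise_family M F u N P
  for M F :: "'a measure" and u N P +
  fixes R :: "nat set" and q K \<sigma> :: real
  assumes R: "R \<subseteq> {..<P}" "R \<noteq> {}" and q: "q \<ge> 4" and K: "K \<ge> 1"
    and mean0: "\<And>i l. i < N \<Longrightarrow> l < P \<Longrightarrow>
        AE \<omega> in M. nn_cond_exp M F (\<lambda>\<omega>. ennreal (max (u i l \<omega>) 0)) \<omega>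
                  = nn_cond_exp M F (\<lambda>\<omega>. ennreal (max (- u i l \<omega>) 0)) \<omega>"
    and second: "\<And>i. i < N \<Longrightarrow>
        AE \<omega> in M. (\<Sum>l\<in>R. nn_cond_exp M F (\<lambda>\<omega>. ennreal ((u i l \<omega>)\<^sup>2)) \<omega>)
                  = ennreal (real (card R) * \<sigma>\<^sup>2)"
begin

text \<open>Built from conditional expectations only, so it lies in \<open>F\<close> and can serve
  as the set \<open>G\<close> of the Chernoff bound.\<close>

definition moment_event :: "'a set" where
  "moment_event = {\<omega> \<in> space M. \<forall>i<N. \<forall>l\<in>R.
     nn_cond_exp M F (\<lambda>\<omega>. ennreal (\<bar>u i l \<omega>\<bar> powr q)) \<omega> \<le> ennreal K}"

lemma finite_R: "finite R" using R(1) finite_subset by blast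

lemma card_R: "real (card R) > 0" using R(2) finite_R by (simp add: card_gt_0_iff)

lemma u_R: "i < N \<Longrightarrow> l \<in> R \<Longrightarrow> u i l \<in> borel_measurable M"
  using R u_meas by auto

lemma moment_event_F: "moment_event \<in> sets F"
proof -
  have sp: "space M = space F" using subalg by (simp add: subalgebra_def)
  have "moment_event = {\<omega> \<in> space F. \<forall>i\<in>{..<N}. \<forall>l\<in>R.
     nn_cond_exp M F (\<lambda>\<omega>. ennreal (\<bar>u i l \<omega>\<bar> powr q)) \<omega> \<le> ennreal K}"
    unfolding moment_event_def sp by auto
  also have "\<dots> \<in> sets F"
    using finite_R by measurable
  finally show ?thesis .
qed

lemma moment_event_M [measurable]: "moment_event \<in> sets M"
  using moment_event_F subalg by (auto simp: subalgebra_def)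

text \<open>Monotonicity and linearity of the nonnegative conditional expectation turn a pointwise
  growth bound into a bound on the event. Negative values of \<open>f\<close> become 0 under
  \<open>ennreal\<close>, which is harmless as the dominating function is nonnegative.\<close>

lemma nn_cond_exp_moment_le:
  fixes f :: "real \<Rightarrow> real"
  assumes il: "i < N" "l \<in> R" and f: "f \<in> borel_measurable borel"
    and bnd: "\<And>x. f x \<le> A + B * \<bar>x\<bar> powr q" and AB: "A \<ge> 0" "B \<ge> 0"
  shows "AE \<omega> in M. \<omega> \<in> moment_event \<longrightarrow> nn_cond_exp M F (\<lambda>\<omega>. ennreal (f (u i l \<omega>))) \<omega> \<le> ennreal (A + B * K)"
proof -
  note [measurable] = u_R[OF il] f
  let ?q = "\<lambda>\<omega>. ennreal (\<bar>u i l \<omega>\<bar> powr q)"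
  have "AE \<omega> in M. nn_cond_exp M F (\<lambda>\<omega>. ennreal (f (u i l \<omega>))) \<omega> \<le> nn_cond_exp M F (\<lambda>\<omega>. ennreal A + ennreal B * ?q \<omega>) \<omega>"
    using bnd AB by (intro nn_cond_exp_mono AE_I2)
      (auto simp: ennreal_mult[symmetric] ennreal_plus[symmetric] simp del: ennreal_plus intro!: ennreal_leI)
  moreover have "AE \<omega> in M. nn_cond_exp M F (\<lambda>\<omega>. ennreal A) \<omega> + nn_cond_exp M F (\<lambda>\<omega>. ennreal B * ?q \<omega>) \<omega>
      = nn_cond_exp M F (\<lambda>\<omega>. ennreal A + ennreal B * ?q \<omega>) \<omega>"
    by (rule nn_cond_exp_sum) measurable
  moreover have "AE \<omega> in M. ennreal A = nn_cond_exp M F (\<lambda>\<omega>. ennreal A) \<omega>"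
    by (rule nn_cond_exp_F_meas) simp
  moreover have "AE \<omega> in M. ennreal B * nn_cond_exp M F ?q \<omega> = nn_cond_exp M F (\<lambda>\<omega>. ennreal B * ?q \<omega>) \<omega>"
    by (rule nn_cond_exp_prod) measurable
  ultimately show ?thesis
  proof eventually_elim
    case (elim \<omega>)
    show ?case
    proof
      assume "\<omega> \<in> moment_event"
      then have "nn_cond_exp M F ?q \<omega> \<le> ennreal K" using il by (auto simp: moment_event_def)
      then have "ennreal A + ennreal B * nn_cond_exp M F ?q \<omega> \<le> ennreal A + ennreal B * ennreal K"
        by (intro add_left_mono mult_left_mono) auto
      also have "\<dots> = ennreal (A + B * K)" using AB K by (simp add: ennreal_mult)
      finally show "nn_cond_exp M F (\<lambda>\<omega>. ennreal (f (u i l \<omega>))) \<omega> \<le> ennreal (A + B * K)"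
        using elim by (metis (no_types, lifting) order_trans)
    qed
  qed
qed

text \<open>\<open>real_cond_exp\<close> subtracts the contribution of the negative part, which can
  only lower the value.\<close>

lemma real_cond_exp_moment_le:
  fixes f :: "real \<Rightarrow> real"
  assumes "i < N" "l \<in> R" "f \<in> borel_measurable borel"
    and "\<And>x. f x \<le> A + B * \<bar>x\<bar> powr q" "A \<ge> 0" "B \<ge> 0"
  shows "AE \<omega> in M. \<omega> \<in> moment_event \<longrightarrow> real_cond_exp M F (\<lambda>\<omega>. f (u i l \<omega>)) \<omega> \<le> A + B * K"
  using nn_cond_exp_moment_le[OF assms]
proof eventually_elim
  case (elim \<omega>)
  show ?case
  proof
    assume "\<omega> \<in> moment_event"
    then have "enn2real (nn_cond_exp M F (\<lambda>\<omega>. ennreal (f (u i l \<omega>))) \<omega>) \<le> A + B * K"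
      using elim assms K by (intro enn2real_leI) auto
    then show "real_cond_exp M F (\<lambda>\<omega>. f (u i l \<omega>)) \<omega> \<le> A + B * K"
      unfolding real_cond_exp_def
      using enn2real_nonneg[of "nn_cond_exp M F (\<lambda>x. ennreal (- f (u i l x))) \<omega>"] by linarith
  qed
qed

text \<open>Positive and negative part of the noise each split into a truncated part and a
  remainder. Since the two totals have equal conditional expectations, those of the truncated parts
  differ by no more than one remainder, and a remainder is at most
  \<open>\<tau> powr (1 - q) * K\<close>.\<close>

lemma trunc_mean_small:
  assumes il: "i < N" "l \<in> R" and \<tau>: "\<tau> > 0"
  shows "AE \<omega> in M. \<omega> \<in> moment_event \<longrightarrow>
     \<bar>real_cond_exp M F (\<lambda>\<omega>. trunc \<tau> (u i l \<omega>)) \<omega>\<bar> \<le> \<tau> powr (1 - q) * K"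
proof -
  note [measurable] = u_R[OF il]
  have lP: "l < P" using il R by auto
  let ?tp = "\<lambda>x. ennreal (max (trunc \<tau> x) 0)" and ?tm = "\<lambda>x. ennreal (max (- trunc \<tau> x) 0)"
  let ?rp = "\<lambda>x. ennreal (max (x - trunc \<tau> x) 0)" and ?rm = "\<lambda>x. ennreal (max (trunc \<tau> x - x) 0)"
  let ?E = "\<lambda>f. nn_cond_exp M F (\<lambda>\<omega>. f (u i l \<omega>))"
  have tail: "\<bar>x - trunc \<tau> x\<bar> \<le> 0 + \<tau> powr (1 - q) * \<bar>x\<bar> powr q" for x
    using powr_tail_bound[of \<tau> x 1 q] \<tau> q by (auto simp: trunc_def)
  have R1: "AE \<omega> in M. \<omega> \<in> moment_event \<longrightarrow> ?E ?rp \<omega> \<le> ennreal (0 + \<tau> powr (1 - q) * K)"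
    using tail by (intro nn_cond_exp_moment_le[OF il, where f = "\<lambda>x. max (x - trunc \<tau> x) 0"])
      (auto simp: abs_le_iff)
  have R2: "AE \<omega> in M. \<omega> \<in> moment_event \<longrightarrow> ?E ?rm \<omega> \<le> ennreal (0 + \<tau> powr (1 - q) * K)"
    using tail by (intro nn_cond_exp_moment_le[OF il, where f = "\<lambda>x. max (trunc \<tau> x - x) 0"])
      (auto simp: abs_le_iff)
  \<comment> \<open>These two bounds serve only to make the truncated parts finite, so that the
    comparison in [0, \<infinity>] can be moved to the reals.\<close>
  have T1: "AE \<omega> in M. \<omega> \<in> moment_event \<longrightarrow> ?E ?tp \<omega> \<le> ennreal (\<tau> + 0 * K)"
    using \<tau> abs_trunc_le[of \<tau>] by (intro nn_cond_exp_moment_le[OF il, where f = "\<lambda>x. max (trunc \<tau> x) 0"])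
      (auto simp: abs_le_iff)
  have T2: "AE \<omega> in M. \<omega> \<in> moment_event \<longrightarrow> ?E ?tm \<omega> \<le> ennreal (\<tau> + 0 * K)"
    using \<tau> abs_trunc_le[of \<tau>] by (intro nn_cond_exp_moment_le[OF il, where f = "\<lambda>x. max (- trunc \<tau> x) 0"])
      (auto simp: abs_le_iff)
  have S1: "AE \<omega> in M. ?E ?tp \<omega> + ?E ?rp \<omega> = nn_cond_exp M F (\<lambda>\<omega>. ?tp (u i l \<omega>) + ?rp (u i l \<omega>)) \<omega>"
    by (rule nn_cond_exp_sum) measurable
  have S2: "AE \<omega> in M. ?E ?tm \<omega> + ?E ?rm \<omega> = nn_cond_exp M F (\<lambda>\<omega>. ?tm (u i l \<omega>) + ?rm (u i l \<omega>)) \<omega>"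
    by (rule nn_cond_exp_sum) measurable
  have s1: "?tp x + ?rp x = ennreal (max x 0)" "?tm x + ?rm x = ennreal (max (- x) 0)" for x
    by (auto simp: trunc_def)
  have s2: "ennreal (max y 0) = ennreal y" for y
    by (auto simp: max_def ennreal_neg)
  show ?thesis
    using mean0[OF il(1) lP] R1 R2 T1 T2 S1 S2
  proof eventually_elim
    case (elim \<omega>)
    show ?case
    proof
      assume w: "\<omega> \<in> moment_event"
      let ?d = "\<tau> powr (1 - q) * K"
      have d0: "?d \<ge> 0" using K by simp
      have e: "?E ?tp \<omega> + ?E ?rp \<omega> = ?E ?tm \<omega> + ?E ?rm \<omega>"
        using elim(1,6,7) unfolding s1 by simp
      have r: "?E ?rp \<omega> \<le> ennreal ?d" "?E ?rm \<omega> \<le> ennreal ?d" using elim(2,3) w by simp_all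
      have t: "?E ?tp \<omega> \<le> ennreal (\<tau> + 0 * K)" "?E ?tm \<omega> \<le> ennreal (\<tau> + 0 * K)"
        using elim(4,5) w by blast+
      have t1: "?E ?tp \<omega> < \<infinity>"
        unfolding infinity_ennreal_def by (rule le_less_trans[OF t(1) ennreal_less_top])
      have t2: "?E ?tm \<omega> < \<infinity>"
        unfolding infinity_ennreal_def by (rule le_less_trans[OF t(2) ennreal_less_top])
      have "?E ?tp \<omega> \<le> ?E ?tm \<omega> + ?E ?rm \<omega>" unfolding e[symmetric] by (rule add_increasing2) auto
      also have "\<dots> \<le> ?E ?tm \<omega> + ennreal ?d" using r by (intro add_left_mono)
      finally have 1: "enn2real (?E ?tp \<omega>) \<le> enn2real (?E ?tm \<omega>) + ?d"
        by (rule enn2real_le_add[OF _ t2 d0])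
      have "?E ?tm \<omega> \<le> ?E ?tp \<omega> + ?E ?rp \<omega>" unfolding e by (rule add_increasing2) auto
      also have "\<dots> \<le> ?E ?tp \<omega> + ennreal ?d" using r by (intro add_left_mono)
      finally have 2: "enn2real (?E ?tm \<omega>) \<le> enn2real (?E ?tp \<omega>) + ?d"
        by (rule enn2real_le_add[OF _ t1 d0])
      from 1 2 show "\<bar>real_cond_exp M F (\<lambda>\<omega>. trunc \<tau> (u i l \<omega>)) \<omega>\<bar> \<le> ?d"
        unfolding real_cond_exp_def s2 by linarith
    qed
  qed
qed

text \<open>The squares of truncation and remainder add up to the squared noise, whose conditional
  moments sum to \<open>card R * \<sigma>^2\<close>. The error is therefore exactly minus the sum of
  the remainder moments, each at most \<open>\<tau> powr (2 - q) * K\<close>.\<close>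

lemma trunc_second_moment:
  assumes i: "i < N" and \<tau>: "\<tau> > 0"
  shows "AE \<omega> in M. \<omega> \<in> moment_event \<longrightarrow>
     \<bar>(\<Sum>l\<in>R. real_cond_exp M F (\<lambda>\<omega>. (trunc \<tau> (u i l \<omega>))\<^sup>2) \<omega>) - real (card R) * \<sigma>\<^sup>2\<bar>
       \<le> real (card R) * (\<tau> powr (2 - q) * K)"
proof -
  let ?d = "\<tau> powr (2 - q) * K"
  let ?E = "\<lambda>f l. nn_cond_exp M F (\<lambda>\<omega>. ennreal (f (u i l \<omega>)))"
  let ?t = "\<lambda>x. (trunc \<tau> x)\<^sup>2" and ?r = "\<lambda>x. (x - trunc \<tau> x)\<^sup>2"
  have d0: "?d \<ge> 0" using K by simp
  have tail: "?r x \<le> 0 + \<tau> powr (2 - q) * \<bar>x\<bar> powr q" for x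
    using powr_tail_bound[of \<tau> x 2 q] \<tau> q by (auto simp: trunc_def powr_numeral)
  have "AE \<omega> in M. \<forall>l\<in>R. \<omega> \<in> moment_event \<longrightarrow> ?E ?r l \<omega> \<le> ennreal (0 + \<tau> powr (2 - q) * K)"
  proof -
    have "AE \<omega> in M. \<omega> \<in> moment_event \<longrightarrow> ?E ?r l \<omega> \<le> ennreal (0 + \<tau> powr (2 - q) * K)" if "l \<in> R" for l
      using i that tail by (intro nn_cond_exp_moment_le) auto
    then show ?thesis unfolding AE_finite_all[OF finite_R] by blast
  qed
  moreover have "AE \<omega> in M. \<forall>l\<in>R. \<omega> \<in> moment_event \<longrightarrow> ?E ?t l \<omega> \<le> ennreal (\<tau>\<^sup>2 + 0 * K)"
  proof -
    have "?t x \<le> \<tau>\<^sup>2 + 0 * \<bar>x\<bar> powr q" for x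
      using power_mono[OF abs_trunc_le[of \<tau> x], of 2] \<tau> by simp
    then have "AE \<omega> in M. \<omega> \<in> moment_event \<longrightarrow> ?E ?t l \<omega> \<le> ennreal (\<tau>\<^sup>2 + 0 * K)" if "l \<in> R" for l
      using i that by (intro nn_cond_exp_moment_le) auto
    then show ?thesis unfolding AE_finite_all[OF finite_R] by blast
  qed
  moreover have "AE \<omega> in M. \<forall>l\<in>R. ?E ?t l \<omega> + ?E ?r l \<omega> = ?E (\<lambda>x. x\<^sup>2) l \<omega>"
  proof -
    have s: "ennreal (?t x) + ennreal (?r x) = ennreal (x\<^sup>2)" for x
      by (auto simp: trunc_def)
    have "AE \<omega> in M. ?E ?t l \<omega> + ?E ?r l \<omega> = ?E (\<lambda>x. x\<^sup>2) l \<omega>" if "l \<in> R" for l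
      using nn_cond_exp_sum[of "\<lambda>\<omega>. ennreal (?t (u i l \<omega>))" "\<lambda>\<omega>. ennreal (?r (u i l \<omega>))"] u_R[OF i that]
      unfolding s by simp
    then show ?thesis unfolding AE_finite_all[OF finite_R] by blast
  qed
  \<comment> \<open>The negative part that \<open>real_cond_exp\<close> subtracts is 0 for a
    square.\<close>
  moreover have "AE \<omega> in M. \<forall>l\<in>R. nn_cond_exp M F (\<lambda>\<omega>. ennreal (- ?t (u i l \<omega>))) \<omega> = 0"
  proof -
    have "AE \<omega> in M. nn_cond_exp M F (\<lambda>\<omega>. ennreal (- ?t (u i l \<omega>))) \<omega> = 0" if "l \<in> R" for l
    proof -
      have "(\<lambda>\<omega>. ennreal (- ?t (u i l \<omega>))) = (\<lambda>_. 0)" by (auto simp: ennreal_neg)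
      then show ?thesis using nn_cond_exp_F_meas[of "\<lambda>_. 0"] by auto
    qed
    then show ?thesis unfolding AE_finite_all[OF finite_R] by blast
  qed
  ultimately show ?thesis
    using second[OF i]
  proof eventually_elim
    case (elim \<omega>)
    show ?case
    proof
      assume w: "\<omega> \<in> moment_event"
      have fin: "?E ?t l \<omega> < \<infinity>" "?E ?r l \<omega> < \<infinity>" "?E (\<lambda>x. x\<^sup>2) l \<omega> < \<infinity>" if "l \<in> R" for l
      proof -
        have t': "?E ?t l \<omega> \<le> ennreal (\<tau>\<^sup>2 + 0 * K)" using elim(2) w that by blast
        show t: "?E ?t l \<omega> < \<infinity>"
          unfolding infinity_ennreal_def by (rule le_less_trans[OF t' ennreal_less_top])
        have r': "?E ?r l \<omega> \<le> ennreal (0 + \<tau> powr (2 - q) * K)" using elim(1) w that by blast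
        show r: "?E ?r l \<omega> < \<infinity>"
          unfolding infinity_ennreal_def by (rule le_less_trans[OF r' ennreal_less_top])
        have e: "?E (\<lambda>x. x\<^sup>2) l \<omega> = ?E ?t l \<omega> + ?E ?r l \<omega>" using elim(3) that by simp
        show "?E (\<lambda>x. x\<^sup>2) l \<omega> < \<infinity>"
          unfolding e using t r by (simp add: ennreal_add_less_top less_top[symmetric])
      qed
      have rc: "real_cond_exp M F (\<lambda>\<omega>. ?t (u i l \<omega>)) \<omega> = enn2real (?E (\<lambda>x. x\<^sup>2) l \<omega>) - enn2real (?E ?r l \<omega>)"
        if "l \<in> R" for l
      proof -
        have "?E (\<lambda>x. x\<^sup>2) l \<omega> = ?E ?t l \<omega> + ?E ?r l \<omega>" using elim(3) that by simp
        then have "enn2real (?E (\<lambda>x. x\<^sup>2) l \<omega>) = enn2real (?E ?t l \<omega>) + enn2real (?E ?r l \<omega>)"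
          using fin[OF that] by (simp add: enn2real_plus)
        then show ?thesis using elim(4) that by (simp add: real_cond_exp_def)
      qed
      have "(\<Sum>l\<in>R. enn2real (?E (\<lambda>x. x\<^sup>2) l \<omega>)) = real (card R) * \<sigma>\<^sup>2"
      proof -
        have "ennreal (\<Sum>l\<in>R. enn2real (?E (\<lambda>x. x\<^sup>2) l \<omega>)) = (\<Sum>l\<in>R. ?E (\<lambda>x. x\<^sup>2) l \<omega>)"
          using fin(3) by (subst sum_ennreal[symmetric]) (auto intro!: sum.cong ennreal_enn2real)
        then show ?thesis using elim(5) by (simp add: sum_nonneg)
      qed
      then have "(\<Sum>l\<in>R. real_cond_exp M F (\<lambda>\<omega>. ?t (u i l \<omega>)) \<omega>) - real (card R) * \<sigma>\<^sup>2
          = - (\<Sum>l\<in>R. enn2real (?E ?r l \<omega>))"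
        using rc by (simp add: sum_subtractf)
      moreover have "(\<Sum>l\<in>R. enn2real (?E ?r l \<omega>)) \<le> (\<Sum>l\<in>R. ?d)"
        using elim(1) w d0 by (intro sum_mono enn2real_leI) auto
      moreover have "(\<Sum>l\<in>R. enn2real (?E ?r l \<omega>)) \<ge> 0" by (intro sum_nonneg) auto
      ultimately show "\<bar>(\<Sum>l\<in>R. real_cond_exp M F (\<lambda>\<omega>. ?t (u i l \<omega>)) \<omega>) - real (card R) * \<sigma>\<^sup>2\<bar>
         \<le> real (card R) * ?d" by simp
    qed
  qed
qed

text \<open>Markov's inequality with the q-th power. As \<open>moment_event\<close> is in
  \<open>F\<close>, under the integral the power may be exchanged for its conditional expectation,
  which is at most \<open>K\<close> there.\<close>

lemma truncation_prob:
  assumes il: "i < N" "l \<in> R" and \<tau>: "\<tau> > 0"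
  shows "measure M {\<omega> \<in> moment_event. \<bar>u i l \<omega>\<bar> > \<tau>} \<le> \<tau> powr (- q) * K"
proof -
  note [measurable] = u_R[OF il]
  let ?q = "\<lambda>\<omega>. ennreal (\<bar>u i l \<omega>\<bar> powr q)"
  let ?A = "{\<omega> \<in> moment_event. \<bar>u i l \<omega>\<bar> > \<tau>}"
  have iF: "(indicator moment_event :: 'a \<Rightarrow> ennreal) \<in> borel_measurable F"
    using moment_event_F by measurable
  have "emeasure M ?A = (\<integral>\<^sup>+\<omega>. indicator ?A \<omega> \<partial>M)" by (simp add: nn_integral_indicator)
  also have "\<dots> \<le> (\<integral>\<^sup>+\<omega>. ennreal (\<tau> powr (- q)) * (indicator moment_event \<omega> * ?q \<omega>) \<partial>M)"
  proof (rule nn_integral_mono)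
    fix \<omega>
    show "indicator ?A \<omega> \<le> ennreal (\<tau> powr (- q)) * (indicator moment_event \<omega> * ?q \<omega>)"
      using powr_tail_bound[of \<tau> "u i l \<omega>" 0 q] \<tau> q
      by (auto simp: indicator_def ennreal_mult[symmetric] simp del: ennreal_1 simp flip: ennreal_1 intro!: ennreal_leI split: if_splits)
  qed
  also have "\<dots> = ennreal (\<tau> powr (- q)) * (\<integral>\<^sup>+\<omega>. indicator moment_event \<omega> * ?q \<omega> \<partial>M)"
    by (rule nn_integral_cmult) measurable
  also have "(\<integral>\<^sup>+\<omega>. indicator moment_event \<omega> * ?q \<omega> \<partial>M)
      = (\<integral>\<^sup>+\<omega>. indicator moment_event \<omega> * nn_cond_exp M F ?q \<omega> \<partial>M)"
    by (rule nn_cond_exp_intg[OF iF, symmetric]) measurable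
  also have "\<dots> \<le> (\<integral>\<^sup>+\<omega>. ennreal K \<partial>M)"
    using il by (intro nn_integral_mono) (auto simp: indicator_def moment_event_def)
  also have "\<dots> = ennreal K" by (simp add: emeasure_space_1)
  finally have "emeasure M ?A \<le> ennreal (\<tau> powr (- q)) * ennreal K"
    by (simp add: mult_left_mono)
  then show ?thesis using K by (simp add: emeasure_eq_measure ennreal_mult[symmetric])
qed

end

section \<open>Deviation of the observed distances\<close>

context noise_family
begin

text \<open>The one-sided bound is applied to \<open>c\<close> and to \<open>- c\<close>. The random
  conditional mean is then replaced by the constant \<open>m0\<close> at the price of the bias
  \<open>b\<close>.\<close>

lemma conditional_Chernoff_two_sided:
  fixes g h :: "real \<Rightarrow> real" and c :: "nat \<Rightarrow> 'a \<Rightarrow> real"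
  assumes ij: "i < N" "j < N" "i \<noteq> j" and R: "R \<subseteq> {..<P}"
    and g: "g \<in> borel_measurable borel" "\<And>x. \<bar>g x\<bar> \<le> Bg"
    and h: "h \<in> borel_measurable borel" "\<And>x. \<bar>h x\<bar> \<le> Bh"
    and c: "\<And>l. l \<in> R \<Longrightarrow> c l \<in> borel_measurable F" "\<And>l x. l \<in> R \<Longrightarrow> x \<in> space M \<Longrightarrow> \<bar>c l x\<bar> \<le> Bc"
    and lam: "lam \<ge> 0" "lam * (Bc * (Bg * Bh)) \<le> 1"
    and G: "G \<in> sets F"
    and V: "AE x in M. x \<in> G \<longrightarrow> (\<forall>l\<in>R. (c l x)\<^sup>2 * (real_cond_exp M F (\<lambda>x. (g (u i l x))\<^sup>2) x
         * real_cond_exp M F (\<lambda>x. (h (u j l x))\<^sup>2) x) \<le> V)"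
    and b: "AE x in M. x \<in> G \<longrightarrow> \<bar>(\<Sum>l\<in>R. c l x * (real_cond_exp M F (\<lambda>x. g (u i l x)) x
         * real_cond_exp M F (\<lambda>x. h (u j l x)) x)) - m0\<bar> \<le> b"
  shows "measure M {x \<in> G. \<bar>(\<Sum>l\<in>R. c l x * (g (u i l x) * h (u j l x))) - m0\<bar> \<ge> b + t}
      \<le> 2 * exp (lam\<^sup>2 * (real (card R) * V) - lam * t)"
proof -
  let ?W = "\<lambda>x. \<Sum>l\<in>R. c l x * (g (u i l x) * h (u j l x))"
  let ?m = "\<lambda>x. \<Sum>l\<in>R. c l x * (real_cond_exp M F (\<lambda>x. g (u i l x)) x * real_cond_exp M F (\<lambda>x. h (u j l x)) x)"
  let ?e = "exp (lam\<^sup>2 * (real (card R) * V) - lam * t)"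
  have um: "u i l \<in> borel_measurable M" "u j l \<in> borel_measurable M" "c l \<in> borel_measurable M" if "l \<in> R" for l
    using that R u_meas ij measurable_from_subalg[OF subalg c(1)] by auto
  have Wm: "?W \<in> borel_measurable M"
    using measurable_compose[OF um(1) g(1)] measurable_compose[OF um(2) h(1)] um(3) by measurable
  have mm: "?m \<in> borel_measurable M" using um(3) by measurable
  have [measurable]: "G \<in> sets M" using G subalg by (auto simp: subalgebra_def)
  let ?A = "{x \<in> G. ?W x \<ge> ?m x + t}"
  let ?B = "{x \<in> G. (\<Sum>l\<in>R. - c l x * (g (u i l x) * h (u j l x))) \<ge>
     (\<Sum>l\<in>R. - c l x * (real_cond_exp M F (\<lambda>x. g (u i l x)) x * real_cond_exp M F (\<lambda>x. h (u j l x)) x)) + t}"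
  have A: "measure M ?A \<le> ?e"
    by (rule conditional_Chernoff[OF ij R g h c lam G V])
  have B: "measure M ?B \<le> ?e"
    by (rule conditional_Chernoff[OF ij R g h, where c = "\<lambda>l x. - c l x" and Bc = Bc])
      (use c lam G V in auto)
  have Am: "?A \<in> sets M" using Wm mm by measurable
  have Bm: "?B \<in> sets M" using Wm mm by (simp add: sum_negf) measurable
  have "measure M {x \<in> G. \<bar>?W x - m0\<bar> \<ge> b + t} \<le> measure M (?A \<union> ?B)"
  proof (rule finite_measure_mono_AE)
    show "AE x in M. x \<in> {x \<in> G. \<bar>?W x - m0\<bar> \<ge> b + t} \<longrightarrow> x \<in> ?A \<union> ?B"
      using b by eventually_elim (auto simp: sum_negf abs_if split: if_splits)
  qed (use Am Bm in auto)
  also have "\<dots> \<le> measure M ?A + measure M ?B"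
    by (rule measure_Un_le[OF Am Bm])
  finally show ?thesis using A B by linarith
qed

end

lemma rho_sq_noise_expansion:
  fixes a b v w :: "nat \<Rightarrow> real"
  assumes "card R > 0"
  shows "real (card R) * (rho_sq R (\<lambda>l. a l + v l) (\<lambda>l. b l + w l) - rho_sq R a b - 2 * s)
    = ((\<Sum>l\<in>R. (v l)\<^sup>2) - real (card R) * s) + ((\<Sum>l\<in>R. (w l)\<^sup>2) - real (card R) * s)
      - 2 * (\<Sum>l\<in>R. v l * w l) + 2 * (\<Sum>l\<in>R. (a l - b l) * v l) + 2 * (\<Sum>l\<in>R. (b l - a l) * w l)"
proof -
  have "(\<Sum>l\<in>R. (a l + v l - (b l + w l))\<^sup>2) = (\<Sum>l\<in>R. (a l - b l)\<^sup>2) + (\<Sum>l\<in>R. (v l)\<^sup>2) + (\<Sum>l\<in>R. (w l)\<^sup>2)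
      - 2 * (\<Sum>l\<in>R. v l * w l) + 2 * (\<Sum>l\<in>R. (a l - b l) * v l) + 2 * (\<Sum>l\<in>R. (b l - a l) * w l)"
    unfolding sum_distrib_left sum.distrib[symmetric] sum_subtractf[symmetric]
    by (intro sum.cong refl) (simp add: power2_eq_square algebra_simps)
  moreover have "real (card R) * rho_sq R x y = (\<Sum>l\<in>R. (x l - y l)\<^sup>2)" for x y
    using assms by (simp add: rho_sq_def)
  ultimately show ?thesis by (simp add: right_diff_distrib)
qed

context noise_moments
begin

text \<open>The three terms pay for a failure of the moment bound, for some noise value above
  \<tau>, and for a large truncated sum. The factor 6 is three two-sided tails for each pair.
  \<open>X\<close> is an arbitrary subset of the bad event, so that events written with suprema can
  be inserted without proving them measurable.\<close>

lemma distance_deviation: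
  fixes H :: "nat \<Rightarrow> nat \<Rightarrow> 'a \<Rightarrow> real"
  assumes H: "\<And>i l. i < N \<Longrightarrow> l \<in> R \<Longrightarrow> H i l \<in> borel_measurable F"
    "\<And>i l \<omega>. i < N \<Longrightarrow> l \<in> R \<Longrightarrow> \<omega> \<in> space M \<Longrightarrow> \<bar>H i l \<omega>\<bar> \<le> B"
    and B: "B \<ge> 0" and \<tau>: "\<tau> \<ge> 1"
    and X: "X \<subseteq> {\<omega> \<in> space M. \<exists>i<N. \<exists>j<N. i \<noteq> j \<and>
       \<bar>rho_sq R (\<lambda>l. H i l \<omega> + u i l \<omega>) (\<lambda>l. H j l \<omega> + u j l \<omega>)
          - rho_sq R (\<lambda>l. H i l \<omega>) (\<lambda>l. H j l \<omega>) - 2 * \<sigma>\<^sup>2\<bar> \<ge> 8 * ((1 + 2 * B) * K\<^sup>2 + 1) / \<tau>}"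
  shows "measure M X
    \<le> measure M (space M - moment_event) + real N * real (card R) * (\<tau> powr (- q) * K)
      + 6 * (real N)\<^sup>2 * exp ((1 + K)\<^sup>2 * real (card R) / \<tau> ^ 4 - real (card R) / ((1 + 2 * B) * \<tau> ^ 3))"
proof -
  let ?L = "real (card R)"
  let ?t = "trunc \<tau>"
  \<comment> \<open>\<open>C\<close> dominates both 1 and the differences of \<open>H\<close>. One
    choice of constants serves all three kinds of sums: their summands are at most
    \<open>C * \<tau>^2\<close>, which fixes \<open>lam\<close>; their conditional second moments
    are bounded by 1 + K, (1 + K)^2 and C^2 (1 + K), all at most \<open>V\<close>; and their biases
    are at most \<open>b\<close>.\<close>
  define C where "C = 1 + 2 * B"
  define lam where "lam = 1 / (C * \<tau>\<^sup>2)"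
  define V where "V = (C * (1 + K))\<^sup>2"
  define b where "b = ?L * (C * K\<^sup>2 / \<tau>)"
  define e where "e = exp (lam\<^sup>2 * (?L * V) - lam * (?L / \<tau>))"
  have C: "C \<ge> 1" using B by (simp add: C_def)
  have lam: "lam \<ge> 0" using C by (simp add: lam_def)
  have \<tau>0: "\<tau> > 0" "\<tau> \<ge> 0" using \<tau> by auto
  have lamC: "lam * (C * \<tau>\<^sup>2) = 1" using C \<tau> by (simp add: lam_def)
  have lam': "lam * x \<le> 1" if "x \<le> C * \<tau>\<^sup>2" for x
    using mult_left_mono[OF that lam] lamC by linarith
  have \<tau>sq: "\<tau> \<le> \<tau>\<^sup>2" using \<tau> by (simp add: power2_eq_square)
  have C\<tau>: "\<tau>\<^sup>2 \<le> C * \<tau>\<^sup>2" using mult_right_mono[OF C zero_le_power2] by simp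
  have e_eq: "e = exp ((1 + K)\<^sup>2 * ?L / \<tau> ^ 4 - ?L / (C * \<tau> ^ 3))"
  proof -
    have "lam\<^sup>2 * (?L * V) = (1 + K)\<^sup>2 * ?L / \<tau> ^ 4"
      using C \<tau> by (simp add: lam_def V_def power_divide power_mult_distrib power_mult[symmetric])
    moreover have "lam * (?L / \<tau>) = ?L / (C * \<tau> ^ 3)"
      by (simp add: lam_def power2_eq_square power3_eq_cube mult_ac)
    ultimately show ?thesis by (simp add: e_def)
  qed
  have KK: "1 \<le> K\<^sup>2" "K \<le> K\<^sup>2" using K self_le_power[of K 2] by (auto simp: one_le_power)
  have K1: "1 + K \<ge> 1" using K by simp
  have sm: "\<tau> powr (2 - q) \<le> 1 / \<tau>" "\<tau> powr (1 - q) \<le> 1 / \<tau>" "1 / \<tau> \<le> 1"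
  proof -
    have "\<tau> powr (2 - q) \<le> \<tau> powr (-1)" "\<tau> powr (1 - q) \<le> \<tau> powr (-1)"
      using q \<tau> by (intro powr_mono; linarith)+
    then show "\<tau> powr (2 - q) \<le> 1 / \<tau>" "\<tau> powr (1 - q) \<le> 1 / \<tau>" "1 / \<tau> \<le> 1"
      using \<tau> powr_neg_one[OF \<tau>0(1)] by auto
  qed
  have one: "AE \<omega> in M. real_cond_exp M F (\<lambda>_. 1) \<omega> = 1" by (rule real_cond_exp_F_meas) auto
  have E1: "AE \<omega> in M. \<forall>l\<in>R. \<omega> \<in> moment_event \<longrightarrow> \<bar>real_cond_exp M F (\<lambda>\<omega>. ?t (u i l \<omega>)) \<omega>\<bar> \<le> K / \<tau>" if "i < N" for i
    unfolding AE_finite_all[OF finite_R]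
  proof
    fix l assume "l \<in> R"
    from trunc_mean_small[OF that this \<tau>0(1)]
    show "AE \<omega> in M. \<omega> \<in> moment_event \<longrightarrow> \<bar>real_cond_exp M F (\<lambda>\<omega>. ?t (u i l \<omega>)) \<omega>\<bar> \<le> K / \<tau>"
    proof eventually_elim
      case (elim \<omega>)
      then show ?case using mult_right_mono[OF sm(2), of K] K by auto
    qed
  qed
  have E2: "AE \<omega> in M. \<forall>l\<in>R. \<omega> \<in> moment_event \<longrightarrow> 0 \<le> real_cond_exp M F (\<lambda>\<omega>. (?t (u i l \<omega>))\<^sup>2) \<omega>
      \<and> real_cond_exp M F (\<lambda>\<omega>. (?t (u i l \<omega>))\<^sup>2) \<omega> \<le> 1 + K
      \<and> real_cond_exp M F (\<lambda>\<omega>. ((?t (u i l \<omega>))\<^sup>2)\<^sup>2) \<omega> \<le> 1 + K" if i: "i < N" for i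
    unfolding AE_finite_all[OF finite_R]
  proof
    fix l assume l: "l \<in> R"
    note [measurable] = u_R[OF i l]
    have p: "AE \<omega> in M. 0 \<le> real_cond_exp M F (\<lambda>\<omega>. (?t (u i l \<omega>))\<^sup>2) \<omega>"
      by (rule real_cond_exp_pos) auto
    have "(?t x)\<^sup>2 \<le> 1 + 1 * \<bar>x\<bar> powr q" for x
      using power_le_one_plus_powr[of 2 q x] q by (auto simp: trunc_def add_nonneg_nonneg)
    then have 2: "AE \<omega> in M. \<omega> \<in> moment_event \<longrightarrow> real_cond_exp M F (\<lambda>\<omega>. (?t (u i l \<omega>))\<^sup>2) \<omega> \<le> 1 + 1 * K"
      by (intro real_cond_exp_moment_le[OF i l]) auto
    have "((?t x)\<^sup>2)\<^sup>2 \<le> 1 + 1 * \<bar>x\<bar> powr q" for x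
      using power_le_one_plus_powr[of 4 q x] q by (auto simp: trunc_def add_nonneg_nonneg)
    then have 4: "AE \<omega> in M. \<omega> \<in> moment_event \<longrightarrow> real_cond_exp M F (\<lambda>\<omega>. ((?t (u i l \<omega>))\<^sup>2)\<^sup>2) \<omega> \<le> 1 + 1 * K"
      by (intro real_cond_exp_moment_le[OF i l, where f = "\<lambda>x. ((?t x)\<^sup>2)\<^sup>2"]) auto
    from p 2 4 show "AE \<omega> in M. \<omega> \<in> moment_event \<longrightarrow> 0 \<le> real_cond_exp M F (\<lambda>\<omega>. (?t (u i l \<omega>))\<^sup>2) \<omega>
      \<and> real_cond_exp M F (\<lambda>\<omega>. (?t (u i l \<omega>))\<^sup>2) \<omega> \<le> 1 + K
      \<and> real_cond_exp M F (\<lambda>\<omega>. ((?t (u i l \<omega>))\<^sup>2)\<^sup>2) \<omega> \<le> 1 + K"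
      by eventually_elim auto
  qed
  have KV: "1 + K \<le> V" "(1 + K) * (1 + K) \<le> V" "C\<^sup>2 * (1 + K) \<le> V"
  proof -
    have CC: "1 \<le> C\<^sup>2" using C by (simp add: one_le_power)
    have Ve: "V = C\<^sup>2 * ((1 + K) * (1 + K))" by (simp add: V_def power_mult_distrib power2_eq_square[of "1 + K"])
    have kk: "1 + K \<le> (1 + K) * (1 + K)" using K1 by simp
    show 2: "(1 + K) * (1 + K) \<le> V" unfolding Ve using mult_right_mono[OF CC, of "(1 + K) * (1 + K)"] by simp
    show "1 + K \<le> V" using kk 2 by linarith
    show "C\<^sup>2 * (1 + K) \<le> V" unfolding Ve using kk by (intro mult_left_mono) auto
  qed
  have CCK: "K \<le> C * K\<^sup>2" "K\<^sup>2 \<le> C * K\<^sup>2"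
    using C KK mult_right_mono[OF C, of "K\<^sup>2"] by auto
  \<comment> \<open>Squares fit the two-column form of the Chernoff bound with the constant 1 as the
    function of the second column; \<open>j\<close> is then a dummy index. The linear terms in
    \<open>tail3\<close> are treated the same way.\<close>
  have tail1: "measure M {\<omega> \<in> moment_event. \<bar>(\<Sum>l\<in>R. (?t (u i l \<omega>))\<^sup>2) - ?L * \<sigma>\<^sup>2\<bar> \<ge> b + ?L / \<tau>} \<le> 2 * e"
    if ij: "i < N" "j < N" "i \<noteq> j" for i j
  proof -
    have "measure M {\<omega> \<in> moment_event. \<bar>(\<Sum>l\<in>R. 1 * ((\<lambda>x. (?t x)\<^sup>2) (u i l \<omega>) * (\<lambda>_. 1) (u j l \<omega>))) - ?L * \<sigma>\<^sup>2\<bar> \<ge> b + ?L / \<tau>}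
       \<le> 2 * exp (lam\<^sup>2 * (?L * V) - lam * (?L / \<tau>))"
    proof (rule conditional_Chernoff_two_sided[OF ij R(1), where Bg = "\<tau>\<^sup>2" and Bh = 1 and Bc = 1])
      show "\<bar>(?t x)\<^sup>2\<bar> \<le> \<tau>\<^sup>2" for x
        using power_mono[OF abs_trunc_le[OF \<tau>0(2), of x], of 2] by simp
      show "lam * (1 * (\<tau>\<^sup>2 * 1)) \<le> 1" using C\<tau> by (intro lam') simp
      show "AE x in M. x \<in> moment_event \<longrightarrow> (\<forall>l\<in>R. 1\<^sup>2 * (real_cond_exp M F (\<lambda>x. ((?t (u i l x))\<^sup>2)\<^sup>2) x *
           real_cond_exp M F (\<lambda>x. 1\<^sup>2) x) \<le> V)"
        using E2[OF ij(1)] one by eventually_elim (use KV(1) in fastforce)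
      show "AE x in M. x \<in> moment_event \<longrightarrow> \<bar>(\<Sum>l\<in>R. 1 * (real_cond_exp M F (\<lambda>x. (?t (u i l x))\<^sup>2) x *
           real_cond_exp M F (\<lambda>x. 1) x)) - ?L * \<sigma>\<^sup>2\<bar> \<le> b"
        using trunc_second_moment[OF ij(1) \<tau>0(1)] one
      proof eventually_elim
        case (elim x)
        have "\<tau> powr (2 - q) * K \<le> C * K\<^sup>2 / \<tau>"
          using mult_mono[OF sm(1) CCK(1)] K \<tau>0 by simp
        then have "?L * (\<tau> powr (2 - q) * K) \<le> b" unfolding b_def by (intro mult_left_mono) auto
        then show ?case using elim by auto
      qed
    qed (use lam moment_event_F in auto)
    then show ?thesis by (simp add: e_def)
  qed
  have tail2: "measure M {\<omega> \<in> moment_event. \<bar>(\<Sum>l\<in>R. ?t (u i l \<omega>) * ?t (u j l \<omega>))\<bar> \<ge> b + ?L / \<tau>} \<le> 2 * e"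
    if ij: "i < N" "j < N" "i \<noteq> j" for i j
  proof -
    have "measure M {\<omega> \<in> moment_event. \<bar>(\<Sum>l\<in>R. 1 * (?t (u i l \<omega>) * ?t (u j l \<omega>))) - 0\<bar> \<ge> b + ?L / \<tau>}
       \<le> 2 * exp (lam\<^sup>2 * (?L * V) - lam * (?L / \<tau>))"
    proof (rule conditional_Chernoff_two_sided[OF ij R(1), where Bg = "\<tau>" and Bh = \<tau> and Bc = 1])
      show "lam * (1 * (\<tau> * \<tau>)) \<le> 1" using C\<tau> by (intro lam') (simp add: power2_eq_square)
      show "AE x in M. x \<in> moment_event \<longrightarrow> (\<forall>l\<in>R. 1\<^sup>2 * (real_cond_exp M F (\<lambda>x. (?t (u i l x))\<^sup>2) x *
           real_cond_exp M F (\<lambda>x. (?t (u j l x))\<^sup>2) x) \<le> V)"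
        using E2[OF ij(1)] E2[OF ij(2)]
      proof eventually_elim
        case (elim x)
        show ?case
        proof (intro impI ballI)
          fix l assume "x \<in> moment_event" "l \<in> R"
          with elim have "real_cond_exp M F (\<lambda>x. (?t (u i l x))\<^sup>2) x * real_cond_exp M F (\<lambda>x. (?t (u j l x))\<^sup>2) x
             \<le> (1 + K) * (1 + K)" using K1 by (intro mult_mono) auto
          then show "1\<^sup>2 * (real_cond_exp M F (\<lambda>x. (?t (u i l x))\<^sup>2) x *
           real_cond_exp M F (\<lambda>x. (?t (u j l x))\<^sup>2) x) \<le> V" using KV(2) by simp
        qed
      qed
      show "AE x in M. x \<in> moment_event \<longrightarrow> \<bar>(\<Sum>l\<in>R. 1 * (real_cond_exp M F (\<lambda>x. ?t (u i l x)) x *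
           real_cond_exp M F (\<lambda>x. ?t (u j l x)) x)) - 0\<bar> \<le> b"
        using E1[OF ij(1)] E1[OF ij(2)]
      proof eventually_elim
        case (elim x)
        show ?case
        proof
          assume x: "x \<in> moment_event"
          have "\<bar>(\<Sum>l\<in>R. 1 * (real_cond_exp M F (\<lambda>x. ?t (u i l x)) x * real_cond_exp M F (\<lambda>x. ?t (u j l x)) x)) - 0\<bar>
            \<le> (\<Sum>l\<in>R. \<bar>real_cond_exp M F (\<lambda>x. ?t (u i l x)) x\<bar> * \<bar>real_cond_exp M F (\<lambda>x. ?t (u j l x)) x\<bar>)"
            by (simp add: abs_mult[symmetric])
          also have "\<dots> \<le> (\<Sum>l\<in>R. (K / \<tau>) * (K / \<tau>))"
            using elim x K \<tau>0 by (intro sum_mono mult_mono) auto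
          also have "\<dots> = ?L * (K\<^sup>2 / \<tau> * (1 / \<tau>))" by (simp add: power2_eq_square)
          also have "\<dots> \<le> ?L * (K\<^sup>2 / \<tau> * 1)" using sm(3) \<tau>0 by (intro mult_left_mono) auto
          also have "\<dots> \<le> b" unfolding b_def using CCK \<tau>0 by (auto intro!: mult_left_mono divide_right_mono)
          finally show "\<bar>(\<Sum>l\<in>R. 1 * (real_cond_exp M F (\<lambda>x. ?t (u i l x)) x *
           real_cond_exp M F (\<lambda>x. ?t (u j l x)) x)) - 0\<bar> \<le> b" .
        qed
      qed
    qed (use lam moment_event_F abs_trunc_le[OF \<tau>0(2)] in auto)
    then show ?thesis by (simp add: e_def)
  qed
  have tail3: "measure M {\<omega> \<in> moment_event. \<bar>(\<Sum>l\<in>R. (H i l \<omega> - H j l \<omega>) * ?t (u i l \<omega>))\<bar> \<ge> b + ?L / \<tau>} \<le> 2 * e"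
    if ij: "i < N" "j < N" "i \<noteq> j" for i j
  proof -
    have Hd: "\<bar>H i l x - H j l x\<bar> \<le> C" if "l \<in> R" "x \<in> space M" for l x
      using H(2)[OF ij(1) that] H(2)[OF ij(2) that] by (simp add: C_def)
    have "measure M {\<omega> \<in> moment_event. \<bar>(\<Sum>l\<in>R. (H i l \<omega> - H j l \<omega>) * (?t (u i l \<omega>) * (\<lambda>_. 1) (u j l \<omega>))) - 0\<bar> \<ge> b + ?L / \<tau>}
       \<le> 2 * exp (lam\<^sup>2 * (?L * V) - lam * (?L / \<tau>))"
    proof (rule conditional_Chernoff_two_sided[OF ij R(1), where Bg = "\<tau>" and Bh = 1 and Bc = C])
      show "(\<lambda>\<omega>. H i l \<omega> - H j l \<omega>) \<in> borel_measurable F" if "l \<in> R" for l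
        using H(1)[OF ij(1) that] H(1)[OF ij(2) that] by measurable
      show "lam * (C * (\<tau> * 1)) \<le> 1" using C \<tau>sq by (intro lam') simp
      show "AE x in M. x \<in> moment_event \<longrightarrow> (\<forall>l\<in>R. (H i l x - H j l x)\<^sup>2 * (real_cond_exp M F (\<lambda>x. (?t (u i l x))\<^sup>2) x *
           real_cond_exp M F (\<lambda>x. 1\<^sup>2) x) \<le> V)"
        using E2[OF ij(1)] one AE_space
      proof eventually_elim
        case (elim x)
        show ?case
        proof (intro impI ballI)
          fix l assume l: "x \<in> moment_event" "l \<in> R"
          have "(H i l x - H j l x)\<^sup>2 \<le> C\<^sup>2" using power_mono[OF Hd[OF l(2) elim(3)], of 2] by simp
          then have "(H i l x - H j l x)\<^sup>2 * real_cond_exp M F (\<lambda>x. (?t (u i l x))\<^sup>2) x \<le> C\<^sup>2 * (1 + K)"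
            using elim l by (intro mult_mono) auto
          then show "(H i l x - H j l x)\<^sup>2 * (real_cond_exp M F (\<lambda>x. (?t (u i l x))\<^sup>2) x *
           real_cond_exp M F (\<lambda>x. 1\<^sup>2) x) \<le> V" using KV(3) elim(2) by simp
        qed
      qed
      show "AE x in M. x \<in> moment_event \<longrightarrow> \<bar>(\<Sum>l\<in>R. (H i l x - H j l x) * (real_cond_exp M F (\<lambda>x. ?t (u i l x)) x *
           real_cond_exp M F (\<lambda>x. 1) x)) - 0\<bar> \<le> b"
        using E1[OF ij(1)] one AE_space
      proof eventually_elim
        case (elim x)
        show ?case
        proof
          assume x: "x \<in> moment_event"
          have "\<bar>(\<Sum>l\<in>R. (H i l x - H j l x) * (real_cond_exp M F (\<lambda>x. ?t (u i l x)) x * real_cond_exp M F (\<lambda>x. 1) x)) - 0\<bar>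
            \<le> (\<Sum>l\<in>R. \<bar>H i l x - H j l x\<bar> * \<bar>real_cond_exp M F (\<lambda>x. ?t (u i l x)) x\<bar>)"
            using elim(2) by (simp add: abs_mult[symmetric])
          also have "\<dots> \<le> (\<Sum>l\<in>R. C * (K / \<tau>))"
            using elim x C by (intro sum_mono mult_mono Hd) auto
          also have "\<dots> \<le> b" unfolding b_def using KK C \<tau>0
            by (auto intro!: mult_left_mono divide_right_mono)
          finally show "\<bar>(\<Sum>l\<in>R. (H i l x - H j l x) * (real_cond_exp M F (\<lambda>x. ?t (u i l x)) x *
           real_cond_exp M F (\<lambda>x. 1) x)) - 0\<bar> \<le> b" .
        qed
      qed
    qed (use lam moment_event_F abs_trunc_le[OF \<tau>0(2)] Hd in auto)
    then show ?thesis by (simp add: e_def)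
  qed
  define T1 where "T1 i = {\<omega> \<in> moment_event. \<bar>(\<Sum>l\<in>R. (?t (u i l \<omega>))\<^sup>2) - ?L * \<sigma>\<^sup>2\<bar> \<ge> b + ?L / \<tau>}" for i
  define T2 where "T2 i j = {\<omega> \<in> moment_event. \<bar>(\<Sum>l\<in>R. ?t (u i l \<omega>) * ?t (u j l \<omega>))\<bar> \<ge> b + ?L / \<tau>}" for i j
  define T3 where "T3 i j = {\<omega> \<in> moment_event. \<bar>(\<Sum>l\<in>R. (H i l \<omega> - H j l \<omega>) * ?t (u i l \<omega>))\<bar> \<ge> b + ?L / \<tau>}" for i j
  define T0 where "T0 il = {\<omega> \<in> moment_event. \<bar>u (fst il) (snd il) \<omega>\<bar> > \<tau>}" for il
  \<comment> \<open>Pairs are ordered: the square and the linear term of the second column are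
    controlled by the event of the reversed pair.\<close>
  define Pr where "Pr = {(i, j). i < N \<and> j < N \<and> i \<noteq> j}"
  define T where "T ij = T1 (fst ij) \<union> T2 (fst ij) (snd ij) \<union> T3 (fst ij) (snd ij)" for ij
  have PrN: "Pr \<subseteq> {..<N} \<times> {..<N}" by (auto simp: Pr_def)
  then have finPr: "finite Pr" using finite_subset by blast
  have "card Pr \<le> N * N" using card_mono[OF _ PrN] by simp
  then have cPr: "real (card Pr) \<le> (real N)\<^sup>2" by (metis of_nat_le_iff of_nat_mult power2_eq_square)
  have tu: "(\<lambda>\<omega>. ?t (u i l \<omega>)) \<in> borel_measurable M" if "i < N" "l \<in> R" for i l
    using u_R[OF that] by measurable
  have HM: "H i l \<in> borel_measurable M" if "i < N" "l \<in> R" for i l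
    by (rule measurable_from_subalg[OF subalg H(1)[OF that]])
  have T1m: "T1 i \<in> sets M" if "i < N" for i
  proof -
    have "(\<lambda>\<omega>. \<Sum>l\<in>R. (?t (u i l \<omega>))\<^sup>2) \<in> borel_measurable M" using tu[OF that] by measurable
    then show ?thesis unfolding T1_def by measurable
  qed
  have T2m: "T2 i j \<in> sets M" if "i < N" "j < N" for i j
  proof -
    have "(\<lambda>\<omega>. \<Sum>l\<in>R. ?t (u i l \<omega>) * ?t (u j l \<omega>)) \<in> borel_measurable M"
      using tu[OF that(1)] tu[OF that(2)] by measurable
    then show ?thesis unfolding T2_def by measurable
  qed
  have T3m: "T3 i j \<in> sets M" if "i < N" "j < N" for i j
  proof -
    have "(\<lambda>\<omega>. \<Sum>l\<in>R. (H i l \<omega> - H j l \<omega>) * ?t (u i l \<omega>)) \<in> borel_measurable M"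
      using tu[OF that(1)] HM[OF that(1)] HM[OF that(2)] by measurable
    then show ?thesis unfolding T3_def by measurable
  qed
  have T0m: "T0 il \<in> sets M" if "il \<in> {..<N} \<times> R" for il
  proof -
    have "u (fst il) (snd il) \<in> borel_measurable M" using that u_R by auto
    then show ?thesis unfolding T0_def by measurable
  qed
  have T: "T ij \<in> sets M" "measure M (T ij) \<le> 6 * e" if "ij \<in> Pr" for ij
  proof -
    obtain i j where ij: "ij = (i, j)" "i < N" "j < N" "i \<noteq> j" using \<open>ij \<in> Pr\<close> by (auto simp: Pr_def)
    note m = T1m[OF ij(2)] T2m[OF ij(2,3)] T3m[OF ij(2,3)]
    show "T ij \<in> sets M" using m by (simp add: T_def ij(1))
    have "measure M (T ij) \<le> measure M (T1 i) + measure M (T2 i j) + measure M (T3 i j)"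
      using measure_Un_le[of "T1 i \<union> T2 i j" M "T3 i j"] measure_Un_le[of "T1 i" M "T2 i j"] m
      by (simp add: T_def ij(1))
    then show "measure M (T ij) \<le> 6 * e"
      using tail1[OF ij(2-4)] tail2[OF ij(2-4)] tail3[OF ij(2-4)] unfolding T1_def T2_def T3_def by linarith
  qed
  let ?Ua = "\<Union>il\<in>{..<N} \<times> R. T0 il" and ?Ub = "\<Union>ij\<in>Pr. T ij"
  have "X \<subseteq> (space M - moment_event) \<union> ?Ua \<union> ?Ub"
  proof
    fix \<omega> assume "\<omega> \<in> X"
    with X obtain i j where w: "\<omega> \<in> space M" and ij: "i < N" "j < N" "i \<noteq> j"
      and bad: "\<bar>rho_sq R (\<lambda>l. H i l \<omega> + u i l \<omega>) (\<lambda>l. H j l \<omega> + u j l \<omega>)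
          - rho_sq R (\<lambda>l. H i l \<omega>) (\<lambda>l. H j l \<omega>) - 2 * \<sigma>\<^sup>2\<bar> \<ge> 8 * ((1 + 2 * B) * K\<^sup>2 + 1) / \<tau>"
      by blast
    show "\<omega> \<in> (space M - moment_event) \<union> ?Ua \<union> ?Ub"
    proof (rule ccontr)
      assume "\<omega> \<notin> (space M - moment_event) \<union> ?Ua \<union> ?Ub"
      then have G: "\<omega> \<in> moment_event" and n0: "\<omega> \<notin> ?Ua" and n: "\<omega> \<notin> ?Ub" using w by auto
      have tr: "?t (u i' l \<omega>) = u i' l \<omega>" if "i' < N" "l \<in> R" for i' l
      proof -
        have "\<omega> \<notin> T0 (i', l)" using that by (intro contrapos_nn[OF n0] UN_I[of "(i', l)"]) auto
        then show ?thesis using G by (simp add: T0_def trunc_def not_less)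
      qed
      have P: "(i, j) \<in> Pr" "(j, i) \<in> Pr" using ij by (auto simp: Pr_def)
      with n have "\<omega> \<notin> T (i, j)" "\<omega> \<notin> T (j, i)" by blast+
      then have nn: "\<omega> \<notin> T1 i" "\<omega> \<notin> T1 j" "\<omega> \<notin> T2 i j" "\<omega> \<notin> T3 i j" "\<omega> \<notin> T3 j i"
        by (auto simp: T_def)
      have cardpos: "card R > 0" using card_R by simp
      let ?s = "b + ?L / \<tau>"
      have "\<bar>(\<Sum>l\<in>R. (u i l \<omega>)\<^sup>2) - ?L * \<sigma>\<^sup>2\<bar> < ?s" "\<bar>(\<Sum>l\<in>R. (u j l \<omega>)\<^sup>2) - ?L * \<sigma>\<^sup>2\<bar> < ?s"
        "\<bar>\<Sum>l\<in>R. u i l \<omega> * u j l \<omega>\<bar> < ?s" "\<bar>\<Sum>l\<in>R. (H i l \<omega> - H j l \<omega>) * u i l \<omega>\<bar> < ?s"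
        "\<bar>\<Sum>l\<in>R. (H j l \<omega> - H i l \<omega>) * u j l \<omega>\<bar> < ?s"
        using nn G tr[OF ij(1)] tr[OF ij(2)] by (simp_all add: T1_def T2_def T3_def not_le cong: sum.cong)
      \<comment> \<open>The five coefficients 1, 1, 2, 2, 2 of the expansion add up to 8.\<close>
      moreover have five: "\<bar>x1 + x2 - 2 * x3 + 2 * x4 + 2 * x5\<bar> < 8 * s"
        if "\<bar>x1\<bar> < s" "\<bar>x2\<bar> < s" "\<bar>x3\<bar> < s" "\<bar>x4\<bar> < s" "\<bar>x5\<bar> < s" for x1 x2 x3 x4 x5 s :: real
        using that by linarith
      ultimately have "\<bar>?L * (rho_sq R (\<lambda>l. H i l \<omega> + u i l \<omega>) (\<lambda>l. H j l \<omega> + u j l \<omega>)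
          - rho_sq R (\<lambda>l. H i l \<omega>) (\<lambda>l. H j l \<omega>) - 2 * \<sigma>\<^sup>2)\<bar> < 8 * ?s"
        unfolding rho_sq_noise_expansion[OF cardpos] by (intro five)
      also have "8 * ?s = ?L * (8 * ((1 + 2 * B) * K\<^sup>2 + 1) / \<tau>)"
        using \<tau>0 by (simp add: b_def C_def field_simps)
      finally show False using mult_left_mono[OF bad, of ?L] by (simp only: abs_mult) simp
    qed
  qed
  then have "measure M X \<le> measure M ((space M - moment_event) \<union> ?Ua \<union> ?Ub)"
    using T0m T(1) finPr finite_R by (intro finite_measure_mono) (auto intro!: sets.finite_UN)
  also have "\<dots> \<le> measure M (space M - moment_event) + measure M ?Ua + measure M ?Ub"
  proof -
    have "?Ua \<in> sets M" "?Ub \<in> sets M" using T0m T(1) finPr finite_R by (auto intro!: sets.finite_UN)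
    then show ?thesis
      using measure_Un_le[of "(space M - moment_event) \<union> ?Ua" M ?Ub] measure_Un_le[of "space M - moment_event" M ?Ua]
      by auto
  qed
  also have "measure M ?Ua \<le> real N * ?L * (\<tau> powr (- q) * K)"
  proof -
    have "measure M ?Ua \<le> (\<Sum>il\<in>{..<N} \<times> R. measure M (T0 il))"
      using T0m finite_R by (intro finite_measure_subadditive_finite) auto
    also have "\<dots> \<le> (\<Sum>il\<in>{..<N} \<times> R. \<tau> powr (- q) * K)"
      using truncation_prob[OF _ _ \<tau>0(1)] by (intro sum_mono) (auto simp: T0_def)
    also have "\<dots> = real N * ?L * (\<tau> powr (- q) * K)" by (simp add: card_cartesian_product)
    finally show ?thesis .
  qed
  also have "measure M ?Ub \<le> 6 * (real N)\<^sup>2 * e"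
  proof -
    have "measure M ?Ub \<le> (\<Sum>ij\<in>Pr. measure M (T ij))"
      using T(1) finPr by (intro finite_measure_subadditive_finite) auto
    also have "\<dots> \<le> (\<Sum>ij\<in>Pr. 6 * e)" by (intro sum_mono T)
    also have "\<dots> = real (card Pr) * (6 * e)" by simp
    also have "\<dots> \<le> (real N)\<^sup>2 * (6 * e)" using cPr by (intro mult_right_mono) (auto simp: e_def)
    finally show ?thesis by (simp add: mult_ac)
  qed
  finally show ?thesis unfolding e_eq C_def by simp
qed

end

section \<open>Measurability and asymptotics\<close>

text \<open>The latent \<sigma>-field knows the functions only at deterministic points, while the
  signal evaluates them at the random latent point. Simple functions approximating \<open>X\<close>
  take finitely many values, where evaluation is measurable, and continuity carries this to the
  limit.\<close>

lemma measurable_continuous_random_eval: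
  fixes g :: "'a \<Rightarrow> 'b::{second_countable_topology, metric_space} \<Rightarrow> real"
  assumes g: "\<And>x. (\<lambda>\<omega>. g \<omega> x) \<in> borel_measurable N"
    and cont: "\<And>\<omega>. \<omega> \<in> space N \<Longrightarrow> continuous_on UNIV (g \<omega>)"
    and X: "X \<in> borel_measurable N"
  shows "(\<lambda>\<omega>. g \<omega> (X \<omega>)) \<in> borel_measurable N"
proof -
  obtain Y where Y: "\<And>m. simple_function N (Y m)" and lim: "\<And>\<omega>. \<omega> \<in> space N \<Longrightarrow> (\<lambda>m. Y m \<omega>) \<longlonglongrightarrow> X \<omega>"
    using borel_measurable_implies_sequence_metric[OF X] by metis
  show ?thesis
  proof (rule borel_measurable_LIMSEQ_real)
    show "(\<lambda>m. g \<omega> (Y m \<omega>)) \<longlonglongrightarrow> g \<omega> (X \<omega>)" if "\<omega> \<in> space N" for \<omega>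
      using cont[OF that] lim[OF that]
      by (metis continuous_on_eq_continuous_at continuous_within_tendsto_compose' isCont_def open_UNIV UNIV_I isCont_tendsto_compose)
    show "(\<lambda>\<omega>. g \<omega> (Y m \<omega>)) \<in> borel_measurable N" for m
    proof (rule measurable_compose_countable'[where f = "\<lambda>x \<omega>. g \<omega> x" and I = "Y m ` space N"])
      show "countable (Y m ` space N)" using Y[of m] by (auto simp: simple_function_def countable_finite)
      show "Y m \<in> measurable N (count_space (Y m ` space N))"
        using Y[of m] by (auto simp: simple_function_def measurable_count_space_eq2)
    qed (rule g)
  qed
qed

lemma
  assumes \<alpha>: "\<And>i. i < n \<Longrightarrow> \<alpha> i \<in> borel_measurable M"
    and \<eta>: "\<And>l x. l < p \<Longrightarrow> (\<lambda>\<omega>. \<eta> l \<omega> x) \<in> borel_measurable M"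
  shows subalgebra_latent_sigma: "subalgebra M (latent_sigma M n p \<alpha> \<eta>)"
    and measurable_latent_alpha: "i < n \<Longrightarrow> \<alpha> i \<in> borel_measurable (latent_sigma M n p \<alpha> \<eta>)"
    and measurable_latent_eta: "l < p \<Longrightarrow> (\<lambda>\<omega>. \<eta> l \<omega> x) \<in> borel_measurable (latent_sigma M n p \<alpha> \<eta>)"
proof -
  define S where "S = {\<alpha> i -` B \<inter> space M | i B. i < n \<and> B \<in> sets borel} \<union>
      {(\<lambda>\<omega>. \<eta> l \<omega> x) -` B \<inter> space M | l x B. l < p \<and> B \<in> sets borel}"
  have S: "S \<subseteq> sets M" unfolding S_def using \<alpha> \<eta> by (auto intro: measurable_sets)
  have SP: "S \<subseteq> Pow (space M)" unfolding S_def by auto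
  have L: "latent_sigma M n p \<alpha> \<eta> = sigma (space M) S" by (simp add: latent_sigma_def S_def)
  have sp: "space (latent_sigma M n p \<alpha> \<eta>) = space M" unfolding L using SP by (rule space_measure_of)
  have se: "sets (latent_sigma M n p \<alpha> \<eta>) = sigma_sets (space M) S" unfolding L using SP by (rule sets_measure_of)
  show "subalgebra M (latent_sigma M n p \<alpha> \<eta>)"
    unfolding subalgebra_def sp se using sets.sigma_sets_subset[OF S] by simp
  show "\<alpha> i \<in> borel_measurable (latent_sigma M n p \<alpha> \<eta>)" if "i < n"
    by (rule measurableI) (use that in \<open>auto simp: sp se S_def intro!: sigma_sets.Basic\<close>)
  show "(\<lambda>\<omega>. \<eta> l \<omega> x) \<in> borel_measurable (latent_sigma M n p \<alpha> \<eta>)" if "l < p"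
    by (rule measurableI) (use that in \<open>auto simp: sp se S_def intro!: sigma_sets.Basic\<close>)
qed

text \<open>The dominating \<open>C\<close> need not be measurable, hence the passage to the supremum of the \<open>Y i\<close>.\<close>

lemma (in prob_space) AE_finite_tight:
  fixes Y :: "'i \<Rightarrow> 'a \<Rightarrow> ennreal"
  assumes I: "countable I" and Y: "\<And>i. i \<in> I \<Longrightarrow> Y i \<in> borel_measurable M"
    and C: "AE \<omega> in M. \<forall>i\<in>I. Y i \<omega> \<le> ennreal (C \<omega>)" and \<delta>: "\<delta> > 0"
  shows "\<exists>K\<ge>1. \<forall>J\<subseteq>I. prob (space M - {\<omega> \<in> space M. \<forall>i\<in>J. Y i \<omega> \<le> ennreal K}) \<le> \<delta>"
proof -
  define S where "S \<omega> = (SUP i\<in>I. Y i \<omega>)" for \<omega>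
  have [measurable]: "S \<in> borel_measurable M" unfolding S_def using I Y by (intro borel_measurable_SUP)
  \<comment> \<open>These sets decrease to the event that \<open>S\<close> is infinite, a null set,
    so continuity from above yields a level \<open>m\<close>.\<close>
  define A where "A m = {\<omega> \<in> space M. of_nat m < S \<omega>}" for m
  have A: "A m \<in> sets M" for m unfolding A_def by measurable
  have dec: "decseq A"
    unfolding A_def decseq_def by (auto intro: le_less_trans simp: of_nat_le_iff[where ?'a = ennreal, symmetric] simp del: of_nat_le_iff)
  have "AE \<omega> in M. S \<omega> < \<infinity>"
    using C
  proof eventually_elim
    case (elim \<omega>)
    then have "S \<omega> \<le> ennreal (C \<omega>)" unfolding S_def by (intro SUP_least) auto
    then show ?case by (metis ennreal_less_top infinity_ennreal_def le_less_trans)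
  qed
  then have "AE \<omega> in M. \<omega> \<notin> (\<Inter>m. A m)"
  proof eventually_elim
    case (elim \<omega>)
    then obtain m where "S \<omega> \<le> of_nat m"
      using ennreal_Ex_less_of_nat[of "S \<omega>"] less_imp_le by fastforce
    then show ?case by (auto simp: A_def not_less intro!: exI[of _ m])
  qed
  then have "prob (\<Inter>m. A m) = 0"
    using A by (subst prob_eq_0) (auto intro!: sets.countable_INT)
  moreover have "(\<lambda>m. prob (A m)) \<longlonglongrightarrow> prob (\<Inter>m. A m)"
    using A dec by (intro finite_Lim_measure_decseq) auto
  ultimately have "(\<lambda>m. prob (A m)) \<longlonglongrightarrow> 0" by simp
  then have "\<forall>\<^sub>F m in sequentially. prob (A m) < \<delta>" using \<delta> by (rule order_tendstoD)
  then have "\<forall>\<^sub>F m in sequentially. prob (A m) < \<delta> \<and> m \<ge> 1"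
    using eventually_ge_at_top by eventually_elim auto
  then obtain m where m: "prob (A m) < \<delta>" "m \<ge> 1"
    by (metis (no_types, lifting) eventually_sequentially order_refl)
  show ?thesis
  proof (intro exI[of _ "real m"] conjI allI impI)
    fix J assume J: "J \<subseteq> I"
    \<comment> \<open>The exceedance event of any subfamily lies in the same \<open>A m\<close>.
      This is what makes the level uniform over the asymptotic index later.\<close>
    have "space M - {\<omega> \<in> space M. \<forall>i\<in>J. Y i \<omega> \<le> ennreal (real m)} \<subseteq> A m"
    proof
      fix \<omega> assume "\<omega> \<in> space M - {\<omega> \<in> space M. \<forall>i\<in>J. Y i \<omega> \<le> ennreal (real m)}"
      then obtain i where i: "\<omega> \<in> space M" "i \<in> J" "ennreal (real m) < Y i \<omega>" by (auto simp: not_le)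
      have "Y i \<omega> \<le> S \<omega>" unfolding S_def using i J by (auto intro: SUP_upper)
      with i show "\<omega> \<in> A m" by (auto simp: A_def ennreal_of_nat_eq_real_of_nat)
    qed
    then have "prob (space M - {\<omega> \<in> space M. \<forall>i\<in>J. Y i \<omega> \<le> ennreal (real m)}) \<le> prob (A m)"
      using A by (rule finite_measure_mono)
    with m show "prob (space M - {\<omega> \<in> space M. \<forall>i\<in>J. Y i \<omega> \<le> ennreal (real m)}) \<le> \<delta>" by simp
  qed (use m in simp)
qed

lemma lesssim_PI:
  assumes "\<And>\<delta>. \<delta> > 0 \<Longrightarrow> \<exists>E. \<forall>\<epsilon>\<ge>E. \<forall>\<^sub>F k in sequentially.
      measure M {\<omega> \<in> space M. ereal \<epsilon> * \<bar>B k \<omega>\<bar> \<le> \<bar>A k \<omega>\<bar>} \<le> \<delta>"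
  shows "lesssim_P M A B"
  unfolding lesssim_P_def
proof (rule order_tendstoI)
  let ?l = "\<lambda>\<epsilon>. limsup (\<lambda>k. ereal (measure M {\<omega> \<in> space M. ereal \<epsilon> * \<bar>B k \<omega>\<bar> \<le> \<bar>A k \<omega>\<bar>}))"
  fix a :: ereal
  {
    assume "a < 0"
    have "0 \<le> ?l \<epsilon>" for \<epsilon> by (rule le_Limsup) auto
    then show "\<forall>\<^sub>F \<epsilon> in at_top. a < ?l \<epsilon>" using \<open>a < 0\<close> by (intro always_eventually allI) (rule less_le_trans)
  next
    assume "0 < a"
    then obtain \<delta> where \<delta>: "0 < ereal \<delta>" "ereal \<delta> < a" using ereal_dense2 by blast
    then obtain E where E: "\<And>\<epsilon>. \<epsilon> \<ge> E \<Longrightarrow> \<forall>\<^sub>F k in sequentially.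
      measure M {\<omega> \<in> space M. ereal \<epsilon> * \<bar>B k \<omega>\<bar> \<le> \<bar>A k \<omega>\<bar>} \<le> \<delta>" using assms[of \<delta>] by auto
    have "?l \<epsilon> < a" if "\<epsilon> \<ge> E" for \<epsilon>
    proof -
      have "?l \<epsilon> \<le> ereal \<delta>" using E[OF that] by (intro Limsup_bounded) auto
      then show ?thesis using \<delta> by simp
    qed
    then show "\<forall>\<^sub>F \<epsilon> in at_top. ?l \<epsilon> < a" using eventually_at_top_linorder by blast
  }
qed

lemma limsup_small_at_right:
  assumes "((\<lambda>\<Delta>. limsup (\<lambda>k. ereal (f \<Delta> k))) \<longlongrightarrow> 0) (at_right (0::real))" "\<delta> > 0"
  shows "\<exists>\<Delta>>0. \<forall>\<^sub>F k in sequentially. f \<Delta> k \<le> \<delta>"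
proof -
  have "\<forall>\<^sub>F \<Delta> in at_right 0. limsup (\<lambda>k. ereal (f \<Delta> k)) < ereal \<delta>"
    using assms by (intro order_tendstoD(2)[OF assms(1)]) auto
  then obtain b where b: "b > 0" "\<And>\<Delta>. 0 < \<Delta> \<Longrightarrow> \<Delta> < b \<Longrightarrow> limsup (\<lambda>k. ereal (f \<Delta> k)) < ereal \<delta>"
    unfolding eventually_at_right_field by auto
  then have "limsup (\<lambda>k. ereal (f (b/2) k)) < ereal \<delta>" by simp
  then have "\<forall>\<^sub>F k in sequentially. ereal (f (b/2) k) < ereal \<delta>" by (rule Limsup_lessD)
  then have "\<forall>\<^sub>F k in sequentially. f (b/2) k \<le> \<delta>" by eventually_elim simp
  then show ?thesis using b(1) by (intro exI[of _ "b/2"]) auto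
qed

text \<open>Used to bound the distance between latent points by the diameter of their compact
  support.\<close>

lemma (in prob_space) distributed_AE_support:
  assumes "distributed M lborel X (\<lambda>x. ennreal (f x))" "closed A" "\<And>x. x \<notin> A \<Longrightarrow> f x = 0"
  shows "AE \<omega> in M. X \<omega> \<in> A"
proof -
  have X: "X \<in> borel_measurable M" using distributed_measurable[OF assms(1)] by simp
  have A: "- A \<in> sets borel" using assms(2) by (auto intro: borel_open)
  have "emeasure M (X -` (- A) \<inter> space M) = (\<integral>\<^sup>+x. ennreal (f x) * indicator (- A) x \<partial>lborel)"
    using A by (intro distributed_emeasure[OF assms(1)]) auto
  also have "(\<lambda>x. ennreal (f x) * indicator (- A) x) = (\<lambda>_. 0)"
    by (intro ext) (auto simp: indicator_def assms(3))
  finally have "emeasure M (X -` (- A) \<inter> space M) = 0" by simp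
  moreover have "X -` (- A) \<inter> space M \<in> sets M" using X A by (rule measurable_sets)
  ultimately show ?thesis
    by (intro AE_I[of _ _ "X -` (- A) \<inter> space M"]) auto
qed

section \<open>Consequences of the rate condition for n, p and the error terms\<close>

context
  fixes n p :: "nat \<Rightarrow> nat" and \<nu> :: real
  assumes n_lim: "filterlim n at_top sequentially"
    and p_lim: "filterlim p at_top sequentially" and nu: "\<nu> > 0"
    and rate: "(\<lambda>k. real (n k) powr (4 / \<nu>) * ln (real (n k)) powr ((\<nu> - 2) / \<nu>) / real (p k)) \<in> O(\<lambda>_. 1)"
begin

lemma real_n_lim: "filterlim (\<lambda>k. real (n k)) at_top sequentially"
  by (rule filterlim_compose[OF filterlim_real_sequentially n_lim])

lemma real_p_lim: "filterlim (\<lambda>k. real (p k)) at_top sequentially"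
  by (rule filterlim_compose[OF filterlim_real_sequentially p_lim])

text \<open>The power of the logarithm has the sign of \<nu> - 2, so it cannot simply be dropped. A
  spare factor n^(1/\<nu>) dominates it in either case, which lowers the exponent from 4/\<nu> to
  3/\<nu>.\<close>

lemma n_powr_le_p: "\<exists>C>0. \<forall>\<^sub>F k in sequentially. real (n k) powr (3 / \<nu>) \<le> C * real (p k)"
proof -
  obtain C where C: "C > 0" "\<forall>\<^sub>F k in sequentially.
      norm (real (n k) powr (4 / \<nu>) * ln (real (n k)) powr ((\<nu> - 2) / \<nu>) / real (p k)) \<le> C * norm (1::real)"
    using rate by (elim landau_o.bigE)
  define s where "s = 1 / \<nu>"
  define t where "t = (\<nu> - 2) / \<nu>"
  have "s > 0" using nu by (simp add: s_def)
  then have "filterlim (\<lambda>x::real. x powr s * ln x powr t) at_top at_top"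
    by real_asymp
  then have "\<forall>\<^sub>F x::real in at_top. x powr s * ln x powr t \<ge> 1"
    unfolding filterlim_at_top by blast
  then have ev: "\<forall>\<^sub>F k in sequentially. real (n k) powr s * ln (real (n k)) powr t \<ge> 1"
    using real_n_lim by (rule eventually_compose_filterlim)
  have "\<forall>\<^sub>F k in sequentially. real (p k) > 0" using real_p_lim unfolding filterlim_at_top_dense by blast
  with C(2) ev have "\<forall>\<^sub>F k in sequentially. real (n k) powr (3 / \<nu>) \<le> C * real (p k)"
  proof eventually_elim
    case (elim k)
    have e: "4 / \<nu> = 3 / \<nu> + s" by (simp add: s_def add_divide_distrib[symmetric])
    have "real (n k) powr (3 / \<nu>) * 1 \<le> real (n k) powr (3 / \<nu>) * (real (n k) powr s * ln (real (n k)) powr t)"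
      using elim(2) by (intro mult_left_mono) auto
    also have "\<dots> = real (n k) powr (4 / \<nu>) * ln (real (n k)) powr t"
      unfolding e by (simp add: powr_add)
    also have "\<dots> \<le> C * real (p k)"
      using elim(1,3) by (simp add: t_def abs_mult field_simps)
    finally show ?case by simp
  qed
  then show ?thesis using C(1) by blast
qed

lemma n_le_p_powr: "\<exists>C>0. \<forall>\<^sub>F k in sequentially. real (n k) \<le> C * real (p k) powr (\<nu> / 3)"
proof -
  obtain C where C: "C > 0" "\<forall>\<^sub>F k in sequentially. real (n k) powr (3 / \<nu>) \<le> C * real (p k)"
    using n_powr_le_p by blast
  from C(2) have "\<forall>\<^sub>F k in sequentially. real (n k) \<le> C powr (\<nu> / 3) * real (p k) powr (\<nu> / 3)"
  proof eventually_elim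
    case (elim k)
    then have "(real (n k) powr (3 / \<nu>)) powr (\<nu> / 3) \<le> (C * real (p k)) powr (\<nu> / 3)"
      using nu by (intro powr_mono2) auto
    then show ?case using nu C(1) by (simp add: powr_powr powr_mult)
  qed
  then show ?thesis using C(1) by (intro exI[of _ "C powr (\<nu> / 3)"]) auto
qed

text \<open>Since p is at least a multiple of n^(3/\<nu>), the logarithm of n is negligible against
  p.\<close>

lemma matching_rate_tendsto_0: "(\<lambda>k. (ln (real (n k)) / real (p k)) powr (1/4)) \<longlonglongrightarrow> 0"
proof -
  obtain C where C: "C > 0" "\<forall>\<^sub>F k in sequentially. real (n k) powr (3 / \<nu>) \<le> C * real (p k)"
    using n_powr_le_p by blast
  define s where "s = 3 / \<nu>"
  have s: "s > 0" using nu by (simp add: s_def)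
  have "((\<lambda>x::real. (C * ln x / x powr s) powr (1/4)) \<longlongrightarrow> 0) at_top"
    using s C(1) by real_asymp
  then have lim: "(\<lambda>k. (C * ln (real (n k)) / real (n k) powr s) powr (1/4)) \<longlonglongrightarrow> 0"
    using real_n_lim by (rule filterlim_compose)
  have "\<forall>\<^sub>F k in sequentially. real (n k) > 1" "\<forall>\<^sub>F k in sequentially. real (p k) > 0"
    using real_n_lim real_p_lim unfolding filterlim_at_top_dense by blast+
  with C(2) have "\<forall>\<^sub>F k in sequentially. (ln (real (n k)) / real (p k)) powr (1/4) \<le> (C * ln (real (n k)) / real (n k) powr s) powr (1/4)"
  proof eventually_elim
    case (elim k)
    have "real (n k) powr s > 0" using elim by simp
    moreover have "ln (real (n k)) * real (n k) powr s \<le> ln (real (n k)) * (C * real (p k))"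
      using elim by (intro mult_left_mono) (auto simp: s_def)
    ultimately have "ln (real (n k)) / real (p k) \<le> C * ln (real (n k)) / real (n k) powr s"
      using elim by (simp add: field_simps)
    then show ?case using elim by (intro powr_mono2) auto
  qed
  then show ?thesis
    by (intro tendsto_sandwich[OF _ _ tendsto_const lim]) auto
qed

text \<open>Once n \<ge> e the logarithm is at least 1, so deviations of order p^(-1/4), the
  reciprocal of the truncation level, lie within the claimed rate.\<close>

lemma matching_rate_lower:
  "\<forall>\<^sub>F k in sequentially. real (p k) \<ge> 1 \<and> 1 / real (p k) powr (1/4) \<le> (ln (real (n k)) / real (p k)) powr (1/4)"
proof -
  have "\<forall>\<^sub>F k in sequentially. real (n k) \<ge> exp 1" "\<forall>\<^sub>F k in sequentially. real (p k) \<ge> 1"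
    using real_n_lim real_p_lim unfolding filterlim_at_top by blast+
  then show ?thesis
  proof eventually_elim
    case (elim k)
    then have "real (n k) > 0" using exp_gt_zero[of "1::real"] by linarith
    then have "ln (real (n k)) \<ge> 1" using elim by (simp add: ln_ge_iff)
    then have "(1 / real (p k)) powr (1/4) \<le> (ln (real (n k)) / real (p k)) powr (1/4)"
      using elim by (intro powr_mono2 divide_right_mono) auto
    then show ?case using elim by (simp add: powr_divide)
  qed
qed

text \<open>With n = O(p^(\<nu>/3)) the total exponent of p is \<nu>/3 + 1 - (4 + 2\<nu>)/4 =
  -\<nu>/6.\<close>

lemma truncation_error_tendsto_0:
  assumes L: "\<And>k. L k \<le> real (p k)" "\<And>k. L k \<ge> 0"
  shows "(\<lambda>k. real (n k) * L k * ((real (p k) powr (1/4)) powr (- (4 + 2 * \<nu>)) * K)) \<longlonglongrightarrow> 0"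
proof -
  obtain C where C: "C > 0" "\<forall>\<^sub>F k in sequentially. real (n k) \<le> C * real (p k) powr (\<nu> / 3)"
    using n_le_p_powr by blast
  have "((\<lambda>x::real. C * x powr (\<nu> / 3) * x * ((x powr (1/4)) powr (- (4 + 2 * \<nu>)) * \<bar>K\<bar>)) \<longlongrightarrow> 0) at_top"
  proof (rule Lim_transform_eventually)
    define s where "s = \<nu> / 6"
    have "s > 0" using nu by (simp add: s_def)
    then show "((\<lambda>x::real. C * \<bar>K\<bar> * x powr (- s)) \<longlongrightarrow> 0) at_top" by real_asymp
    show "\<forall>\<^sub>F x::real in at_top. C * \<bar>K\<bar> * x powr (- s)
        = C * x powr (\<nu> / 3) * x * ((x powr (1/4)) powr (- (4 + 2 * \<nu>)) * \<bar>K\<bar>)"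
      using eventually_gt_at_top[of "0::real"]
    proof eventually_elim
      case (elim x)
      have "x powr (\<nu> / 3) * x * (x powr (1/4)) powr (- (4 + 2 * \<nu>)) = x powr (\<nu> / 3 + 1 + (1/4) * (- (4 + 2 * \<nu>)))"
        using elim by (simp add: powr_add powr_powr)
      also have "\<nu> / 3 + 1 + (1/4) * (- (4 + 2 * \<nu>)) = - s" by (simp add: s_def field_simps)
      finally show ?case by simp
    qed
  qed
  then have lim: "(\<lambda>k. C * real (p k) powr (\<nu> / 3) * real (p k) * ((real (p k) powr (1/4)) powr (- (4 + 2 * \<nu>)) * \<bar>K\<bar>)) \<longlonglongrightarrow> 0"
    using real_p_lim by (rule filterlim_compose)
  show ?thesis
  proof (rule Lim_null_comparison[OF _ lim])
    show "\<forall>\<^sub>F k in sequentially. norm (real (n k) * L k * ((real (p k) powr (1/4)) powr (- (4 + 2 * \<nu>)) * K))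
        \<le> C * real (p k) powr (\<nu> / 3) * real (p k) * ((real (p k) powr (1/4)) powr (- (4 + 2 * \<nu>)) * \<bar>K\<bar>)"
      using C(2) by eventually_elim (use L C(1) in \<open>auto simp: abs_mult intro!: mult_mono\<close>)
  qed
qed

text \<open>The fourth power of the truncation level is p, so the variance term is at most
  \<open>V^2\<close>; as \<open>L k \<ge> c * p k\<close>, the gain is at least (c/B) p^(1/4). This
  beats n^2, which is polynomial in p.\<close>

lemma exponential_error_tendsto_0:
  assumes L: "\<And>k. L k \<le> real (p k)" "\<forall>\<^sub>F k in sequentially. c * real (p k) \<le> L k"
    and c: "c > 0" and B: "B > 0"
  shows "(\<lambda>k. 6 * (real (n k))\<^sup>2 * exp (V\<^sup>2 * L k / (real (p k) powr (1/4)) ^ 4 - L k / (B * (real (p k) powr (1/4)) ^ 3))) \<longlonglongrightarrow> 0"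
proof -
  obtain C where C: "C > 0" "\<forall>\<^sub>F k in sequentially. real (n k) \<le> C * real (p k) powr (\<nu> / 3)"
    using n_le_p_powr by blast
  define b where "b = c / B"
  have b: "b > 0" using c B by (simp add: b_def)
  have "((\<lambda>x::real. 6 * (C * x powr (\<nu> / 3))\<^sup>2 * exp (V\<^sup>2 - b * x powr (1/4))) \<longlongrightarrow> 0) at_top"
    using C(1) nu b by real_asymp
  then have lim: "(\<lambda>k. 6 * (C * real (p k) powr (\<nu> / 3))\<^sup>2 * exp (V\<^sup>2 - b * real (p k) powr (1/4))) \<longlonglongrightarrow> 0"
    using real_p_lim by (rule filterlim_compose)
  have "\<forall>\<^sub>F k in sequentially. real (p k) > 0" using real_p_lim unfolding filterlim_at_top_dense by blast
  with C(2) L(2) have "\<forall>\<^sub>F k in sequentially. norm (6 * (real (n k))\<^sup>2 * exp (V\<^sup>2 * L k / (real (p k) powr (1/4)) ^ 4 - L k / (B * (real (p k) powr (1/4)) ^ 3)))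
       \<le> 6 * (C * real (p k) powr (\<nu> / 3))\<^sup>2 * exp (V\<^sup>2 - b * real (p k) powr (1/4))"
  proof eventually_elim
    case (elim k)
    let ?t = "real (p k) powr (1/4)"
    have t: "?t > 0" using elim by simp
    have t4: "?t ^ 4 = real (p k)" using elim by (simp add: powr_power)
    have t3: "real (p k) = ?t * ?t ^ 3" using t4 by (simp add: power4_eq_xxxx power3_eq_cube)
    have "V\<^sup>2 * L k / ?t ^ 4 \<le> V\<^sup>2 * 1"
      unfolding t4 using elim L(1)[of k] by (simp add: pos_divide_le_eq mult_left_mono)
    moreover have "b * ?t \<le> L k / (B * ?t ^ 3)"
    proof -
      have "b * ?t * (B * ?t ^ 3) = c * (?t * ?t ^ 3)" using B by (simp add: b_def)
      also have "\<dots> \<le> L k" using elim(2) t3 by simp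
      finally show ?thesis using B t by (simp add: pos_le_divide_eq)
    qed
    ultimately have "exp (V\<^sup>2 * L k / ?t ^ 4 - L k / (B * ?t ^ 3)) \<le> exp (V\<^sup>2 - b * ?t)" by simp
    then show ?case
      using elim(1) C(1) by (auto simp: abs_mult intro!: mult_mono power_mono)
  qed
  then show ?thesis using lim by (rule Lim_null_comparison)
qed

end

text \<open>The gap between \<open>e\<close> and \<open>c\<close> replaces attainment of the
  supremum, and \<open>0 \<le> e\<close> excludes the inserted 0 as the only large element.\<close>

lemma Sup_insert_0_gt_witness:
  fixes f :: "'i \<Rightarrow> 'j \<Rightarrow> real"
  assumes "ereal c \<le> \<bar>Sup (insert 0 {ereal (f i j) | i j. Q i j})\<bar>" "e < c" "0 \<le> e"
  shows "\<exists>i j. Q i j \<and> e < f i j"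
proof (rule ccontr)
  let ?S = "Sup (insert 0 {ereal (f i j) | i j. Q i j})"
  assume "\<not> ?thesis"
  then have le: "?S \<le> ereal e" using assms(3) by (intro Sup_least) (auto simp: not_less)
  have nonneg: "0 \<le> ?S" by (rule Sup_upper) simp
  have "ereal c \<le> ereal e" by (rule order_trans[OF assms(1)[unfolded abs_ereal_ge0[OF nonneg]] le])
  then show False using assms(2) by simp
qed

text \<open>An empty index set is excluded automatically: its infimum is infinite, and so is
  \<epsilon> times it, contradicting the bound by 1.\<close>

lemma Inf_le_witness:
  fixes f :: "'i \<Rightarrow> 'j \<Rightarrow> real"
  assumes "ereal \<epsilon> * \<bar>Inf {ereal (f i j) | i j. Q i j}\<bar> \<le> 1" "\<epsilon> * c > 1" "c > 0"
  shows "\<exists>i j. Q i j \<and> f i j < c"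
proof (rule ccontr)
  let ?S = "Inf {ereal (f i j) | i j. Q i j}"
  assume "\<not> ?thesis"
  then have S: "ereal c \<le> ?S" by (intro Inf_greatest) (auto simp: not_less)
  then have "\<bar>?S\<bar> = ?S" using assms(3) by (intro abs_ereal_ge0) (meson ereal_less(2) less_imp_le order_trans)
  moreover have "\<epsilon> > 0" using assms(2,3) by (smt (verit) mult_nonpos_nonneg)
  ultimately have "ereal \<epsilon> * ereal c \<le> ereal \<epsilon> * \<bar>?S\<bar>"
    using S by (intro ereal_mult_left_mono) auto
  then have "ereal \<epsilon> * ereal c \<le> 1" using assms(1) by (rule order_trans)
  then show False using assms(2) by simp
qed

section \<open>Indirect matching\<close>

theorem mainTheorem5:
  fixes M :: "'a measure"
    and n p :: "nat \<Rightarrow> nat"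
    and Rd :: "nat \<Rightarrow> nat set"
    and alpha :: "nat \<Rightarrow> nat \<Rightarrow> 'a \<Rightarrow> real^'r"
    and eta :: "nat \<Rightarrow> nat \<Rightarrow> 'a \<Rightarrow> real^'r \<Rightarrow> real"
    and u :: "nat \<Rightarrow> nat \<Rightarrow> nat \<Rightarrow> 'a \<Rightarrow> real"
    and A :: "(real^'r) set" and f :: "real^'r \<Rightarrow> real"
    and f_lo f_hi Bd \<nu> \<sigma> c_lo :: real and mbar :: nat
    and C :: "'a \<Rightarrow> real"
    and F :: "nat \<Rightarrow> 'a measure"
  defines "F \<equiv> (\<lambda>k. latent_sigma M (n k) (p k) (alpha k) (eta k))"
  assumes P: "prob_space M"
    \<comment> \<open>asymptotic regime n, p \<rightarrow> \<infinity>\<close>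
    and n_lim: "filterlim n at_top sequentially"
    and p_lim: "filterlim p at_top sequentially"
    \<comment> \<open>row splitting\<close>
    and Rd_sub: "\<And>k. Rd k \<subseteq> {..<p k}"
    and Rd_size: "(\<lambda>k. real (p k)) \<in> O(\<lambda>k. real (card (Rd k)))"
    and Rdd_size: "(\<lambda>k. real (p k)) \<in> O(\<lambda>k. real (card ({..<p k} - Rd k)))"
    \<comment> \<open>Assumption 1(a)\<close>
    and A_cpt: "compact A" and A_cvx: "convex A"
    and f_pos: "0 < f_lo" and f_bnd: "\<And>x. x \<in> A \<Longrightarrow> f_lo \<le> f x \<and> f x \<le> f_hi"
    and f_out: "\<And>x. x \<notin> A \<Longrightarrow> f x = 0"
    and alpha_dist: "\<And>k i. i < n k \<Longrightarrow> distributed M lborel (alpha k i) (\<lambda>x. ennreal (f x))"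
    and alpha_indep: "\<And>k. prob_space.indep_vars M (\<lambda>_. borel) (alpha k) {..<n k}"
    \<comment> \<open>Assumption 1(b)\<close>
    and mbar: "mbar \<ge> 2"
    and eta_meas: "\<And>k l x. l < p k \<Longrightarrow> (\<lambda>\<omega>. eta k l \<omega> x) \<in> borel_measurable M"
    and eta_smooth: "\<And>k l \<omega>. l < p k \<Longrightarrow> \<omega> \<in> space M \<Longrightarrow> Cm_bdd mbar Bd (eta k l \<omega>)"
    \<comment> \<open>noise: measurable, conditionally mean zero\<close>
    and u_meas: "\<And>k i l. i < n k \<Longrightarrow> l < p k \<Longrightarrow> u k i l \<in> borel_measurable M"
    and u_mean0: "\<And>k i l. i < n k \<Longrightarrow> l < p k \<Longrightarrow>
        AE \<omega> in M. nn_cond_exp M (F k) (\<lambda>\<omega>. ennreal (max (u k i l \<omega>) 0)) \<omega>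
                  = nn_cond_exp M (F k) (\<lambda>\<omega>. ennreal (max (- u k i l \<omega>) 0)) \<omega>"
    \<comment> \<open>Assumption 1(c)\<close>
    and u_cindep: "\<And>k. cond_indep_vars M (F k) (\<lambda>il. u k (fst il) (snd il)) ({..<n k} \<times> {..<p k})"
    and nu_pos: "\<nu> > 0"
    and C_bnd: "AE \<omega> in M. \<forall>k i l. i < n k \<longrightarrow> l < p k \<longrightarrow>
        nn_cond_exp M (F k) (\<lambda>\<omega>. ennreal (\<bar>u k i l \<omega>\<bar> powr (2 + \<nu>))) \<omega> \<le> ennreal (C \<omega>)"
    \<comment> \<open>(i)\<close>
    and hyp_i: "\<And>k i. i < n k \<Longrightarrow>
        AE \<omega> in M. (\<Sum>l\<in>Rd k. nn_cond_exp M (F k) (\<lambda>\<omega>. ennreal ((u k i l \<omega>)\<^sup>2)) \<omega>)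
                  = ennreal (real (card (Rd k)) * \<sigma>\<^sup>2)"
    \<comment> \<open>(ii)\<close>
    and hyp_ii: "AE \<omega> in M. \<forall>k i l. i < n k \<longrightarrow> l \<in> Rd k \<longrightarrow>
        nn_cond_exp M (F k) (\<lambda>\<omega>. ennreal (\<bar>u k i l \<omega>\<bar> powr (4 + 2 * \<nu>))) \<omega> \<le> ennreal (C \<omega>)"
    \<comment> \<open>(iii)\<close>
    and hyp_iii: "\<And>\<epsilon>. \<epsilon> > 0 \<Longrightarrow>
        ((\<lambda>\<Delta>. limsup (\<lambda>k. ereal (measure M {\<omega> \<in> space M. \<exists>i<n k. \<exists>j<n k.
             rho_sq (Rd k) (\<lambda>l. eta k l \<omega> (alpha k i \<omega>)) (\<lambda>l. eta k l \<omega> (alpha k j \<omega>)) < \<Delta> \<and>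
             norm (alpha k i \<omega> - alpha k j \<omega>) > \<epsilon>}))) \<longlongrightarrow> 0) (at_right 0)"
    \<comment> \<open>(iv)\<close>
    and c_lo_pos: "c_lo > 0"
    and hyp_iv: "(\<lambda>k. measure M {\<omega> \<in> space M. \<forall>i<n k.
        s_min (\<chi> a b. (1 / real (card (Rd k))) *
           (\<Sum>l\<in>Rd k. pderiv_at (eta k l \<omega>) a (alpha k i \<omega>) * pderiv_at (eta k l \<omega>) b (alpha k i \<omega>)))
        \<ge> c_lo}) \<longlonglongrightarrow> 1"
    \<comment> \<open>rate condition\<close>
    and rate: "(\<lambda>k. real (n k) powr (4 / \<nu>) * ln (real (n k)) powr ((\<nu> - 2) / \<nu>) / real (p k))
                 \<in> O(\<lambda>_. 1)"
  shows "indirect_matching M n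
           (\<lambda>k i j \<omega>. rho_sq (Rd k) (\<lambda>l. eta k l \<omega> (alpha k i \<omega>) + u k i l \<omega>)
                                   (\<lambda>l. eta k l \<omega> (alpha k j \<omega>) + u k j l \<omega>))
           (\<lambda>k i j \<omega>. rho_sq (Rd k) (\<lambda>l. eta k l \<omega> (alpha k i \<omega>)) (\<lambda>l. eta k l \<omega> (alpha k j \<omega>)))
           alpha
           (\<lambda>k. (ln (real (n k)) / real (p k)) powr (1/4))
           (2 * \<sigma>\<^sup>2) 2 2"
proof -
  interpret prob_space M by (rule P)
  define Q where "Q = 4 + 2 * \<nu>"
  define L where "L k = real (card (Rd k))" for k
  define H where "H k i l \<omega> = eta k l \<omega> (alpha k i \<omega>)" for k i l \<omega>
  define a where "a k = (ln (real (n k)) / real (p k)) powr (1/4)" for k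
  define \<tau> where "\<tau> k = real (p k) powr (1/4)" for k
  have finRd: "finite (Rd k)" for k using Rd_sub finite_subset by blast
  have lp: "l < p k" if "l \<in> Rd k" for k l using Rd_sub that by auto
  have L: "L k \<le> real (p k)" "L k \<ge> 0" for k
    using card_mono[OF _ Rd_sub[of k]] by (simp_all add: L_def)
  obtain c where c: "c > 0" "\<forall>\<^sub>F k in sequentially. c * real (p k) \<le> L k"
  proof -
    obtain C where C: "C > 0" "\<forall>\<^sub>F k in sequentially. norm (real (p k)) \<le> C * norm (real (card (Rd k)))"
      using Rd_size by (elim landau_o.bigE)
    from C(2) have "\<forall>\<^sub>F k in sequentially. (1 / C) * real (p k) \<le> L k"
      by eventually_elim (use C(1) in \<open>simp add: L_def field_simps\<close>)
    with C(1) that[of "1 / C"] show ?thesis by simp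
  qed
  have Rd_ne: "\<forall>\<^sub>F k in sequentially. Rd k \<noteq> {}"
  proof -
    have "\<forall>\<^sub>F k in sequentially. real (p k) > 0"
      using filterlim_compose[OF filterlim_real_sequentially p_lim] unfolding filterlim_at_top_dense by blast
    with c(2) show ?thesis
    proof eventually_elim
      case (elim k)
      with c(1) have "0 < c * real (p k)" by simp
      with elim show ?case by (auto simp: L_def)
    qed
  qed
  have alphaM: "alpha k i \<in> borel_measurable M" if "i < n k" for k i
    using distributed_measurable[OF alpha_dist[OF that]] by simp
  have sub: "subalgebra M (F k)" for k
    unfolding F_def using alphaM eta_meas by (rule subalgebra_latent_sigma)
  have smooth: "Cm_bdd mbar Bd (eta k l \<omega>)" if "l \<in> Rd k" "\<omega> \<in> space M" for k l \<omega>
    using eta_smooth lp that by blast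
  have HF: "H k i l \<in> borel_measurable (F k)" if i: "i < n k" and l: "l \<in> Rd k" for k i l
  proof -
    have sp: "space (F k) = space M" using sub[of k] by (simp add: subalgebra_def)
    show ?thesis unfolding H_def
    proof (rule measurable_continuous_random_eval[where g = "eta k l"])
      show "(\<lambda>\<omega>. eta k l \<omega> x) \<in> borel_measurable (F k)" for x
        unfolding F_def using alphaM eta_meas lp[OF that(2)] by (rule measurable_latent_eta)
      show "continuous_on UNIV (eta k l \<omega>)" if w: "\<omega> \<in> space (F k)" for \<omega>
        using smooth[OF l] w sp Cm_bdd_continuous by metis
      show "alpha k i \<in> borel_measurable (F k)"
        unfolding F_def using alphaM eta_meas that(1) by (rule measurable_latent_alpha)
    qed
  qed
  have HM: "H k i l \<in> borel_measurable M" if "i < n k" "l \<in> Rd k" for k i l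
    by (rule measurable_from_subalg[OF sub HF[OF that]])
  have HB: "\<bar>H k i l \<omega>\<bar> \<le> \<bar>Bd\<bar>" if "l \<in> Rd k" "\<omega> \<in> space M" for k i l \<omega>
    unfolding H_def using Cm_bdd_bounded[OF smooth[OF that], of "alpha k i \<omega>"] by linarith
  obtain mbar' where mbar': "mbar = Suc mbar'" using mbar by (cases mbar) auto
  have a_pos: "\<forall>\<^sub>F k in sequentially. a k > 0"
    using matching_rate_lower[OF n_lim p_lim nu_pos rate]
    by eventually_elim (auto simp: a_def intro: less_le_trans[rotated])

  \<comment> \<open>Concentration of the observed distances around the latent ones\<close>
  have part_a: "lesssim_P M
       (\<lambda>k \<omega>. Sup (insert 0 {ereal \<bar>rho_sq (Rd k) (\<lambda>l. H k i l \<omega> + u k i l \<omega>) (\<lambda>l. H k j l \<omega> + u k j l \<omega>)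
            - rho_sq (Rd k) (\<lambda>l. H k i l \<omega>) (\<lambda>l. H k j l \<omega>) - 2 * \<sigma>\<^sup>2\<bar> | i j. i < n k \<and> j < n k \<and> i \<noteq> j}))
       (\<lambda>k \<omega>. ereal (a k))"
  proof (rule lesssim_PI)
    fix \<delta> :: real assume \<delta>: "\<delta> > 0"
    \<comment> \<open>The index \<open>k\<close> is part of the family: the random bound in (ii) is
      common to all \<open>k\<close>, so one \<open>K\<close> works for every sample size. The other
      two thirds of \<delta> go to truncation and to the exponential tails.\<close>
    define Y where "Y = (\<lambda>(k, i, l). nn_cond_exp M (F k) (\<lambda>\<omega>. ennreal (\<bar>u k i l \<omega>\<bar> powr Q)))"
    have "AE \<omega> in M. \<forall>kil\<in>{(k, i, l). i < n k \<and> l \<in> Rd k}. Y kil \<omega> \<le> ennreal (C \<omega>)"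
      using hyp_ii by eventually_elim (auto simp: Y_def Q_def)
    then have "\<exists>K\<ge>1. \<forall>J\<subseteq>{(k, i, l). i < n k \<and> l \<in> Rd k}.
       prob (space M - {\<omega> \<in> space M. \<forall>i\<in>J. Y i \<omega> \<le> ennreal K}) \<le> \<delta> / 3"
      using \<delta> by (intro AE_finite_tight) (auto simp: Y_def)
    then obtain K where K: "K \<ge> 1" and tight: "\<And>J. J \<subseteq> {(k, i, l). i < n k \<and> l \<in> Rd k} \<Longrightarrow>
       prob (space M - {\<omega> \<in> space M. \<forall>i\<in>J. Y i \<omega> \<le> ennreal K}) \<le> \<delta> / 3" by blast
    define E where "E = 8 * ((1 + 2 * \<bar>Bd\<bar>) * K\<^sup>2 + 1)"
    have E: "E > 0" by (simp add: E_def add_nonneg_pos)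
    have ev1: "\<forall>\<^sub>F k in sequentially. real (n k) * L k * (\<tau> k powr (- Q) * K) < \<delta> / 3"
      using order_tendstoD(2)[OF truncation_error_tendsto_0[OF n_lim p_lim nu_pos rate L(1) L(2)], of "\<delta> / 3"] \<delta>
      by (simp add: \<tau>_def Q_def)
    have "1 + 2 * \<bar>Bd\<bar> > 0" by simp
    from order_tendstoD(2)[OF exponential_error_tendsto_0[OF n_lim p_lim nu_pos rate L(1) c(2) c(1) this], of "\<delta> / 3" "1 + K"] \<delta>
    have ev2: "\<forall>\<^sub>F k in sequentially. 6 * (real (n k))\<^sup>2 *
        exp ((1 + K)\<^sup>2 * L k / \<tau> k ^ 4 - L k / ((1 + 2 * \<bar>Bd\<bar>) * \<tau> k ^ 3)) < \<delta> / 3"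
      by (simp add: \<tau>_def)
    show "\<exists>E. \<forall>\<epsilon>\<ge>E. \<forall>\<^sub>F k in sequentially.
      measure M {\<omega> \<in> space M. ereal \<epsilon> * \<bar>ereal (a k)\<bar> \<le>
        \<bar>Sup (insert 0 {ereal \<bar>rho_sq (Rd k) (\<lambda>l. H k i l \<omega> + u k i l \<omega>) (\<lambda>l. H k j l \<omega> + u k j l \<omega>)
            - rho_sq (Rd k) (\<lambda>l. H k i l \<omega>) (\<lambda>l. H k j l \<omega>) - 2 * \<sigma>\<^sup>2\<bar> | i j. i < n k \<and> j < n k \<and> i \<noteq> j})\<bar>} \<le> \<delta>"
      (is "\<exists>E. \<forall>\<epsilon>\<ge>E. \<forall>\<^sub>F k in sequentially. measure M (?X \<epsilon> k) \<le> \<delta>")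
    \<comment> \<open>The extra 1 makes E/\<tau> strictly smaller than \<epsilon> times the rate, as
      the extraction of a pair from the supremum requires.\<close>
    proof (intro exI[of _ "E + 1"] allI impI)
      fix \<epsilon> assume \<epsilon>: "\<epsilon> \<ge> E + 1"
      show "\<forall>\<^sub>F k in sequentially. measure M (?X \<epsilon> k) \<le> \<delta>"
        using ev1 ev2 Rd_ne a_pos matching_rate_lower[OF n_lim p_lim nu_pos rate]
      proof eventually_elim
        case (elim k)
        have \<tau>1: "\<tau> k \<ge> 1" using elim(5) by (simp add: \<tau>_def ge_one_powr_ge_zero)
        interpret noise_moments M "F k" "u k" "n k" "p k" "Rd k" Q K \<sigma>
          by unfold_locales (use sub u_meas u_cindep Rd_sub elim(3) nu_pos K u_mean0 hyp_i in \<open>auto simp: Q_def\<close>)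
        have X: "?X \<epsilon> k \<subseteq> {\<omega> \<in> space M. \<exists>i<n k. \<exists>j<n k. i \<noteq> j \<and>
           \<bar>rho_sq (Rd k) (\<lambda>l. H k i l \<omega> + u k i l \<omega>) (\<lambda>l. H k j l \<omega> + u k j l \<omega>)
            - rho_sq (Rd k) (\<lambda>l. H k i l \<omega>) (\<lambda>l. H k j l \<omega>) - 2 * \<sigma>\<^sup>2\<bar> \<ge> 8 * ((1 + 2 * \<bar>Bd\<bar>) * K\<^sup>2 + 1) / \<tau> k}"
        proof
          fix \<omega> assume w: "\<omega> \<in> ?X \<epsilon> k"
          have "E * (1 / \<tau> k) \<le> E * a k" using elim(5) E by (intro mult_left_mono) (auto simp: a_def \<tau>_def)
          also have "\<dots> < \<epsilon> * a k" using \<epsilon> elim(4) by (intro mult_strict_right_mono) auto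
          finally have lt: "E / \<tau> k < \<epsilon> * a k" by simp
          have "\<exists>i j. (i < n k \<and> j < n k \<and> i \<noteq> j) \<and> E / \<tau> k < 
             \<bar>rho_sq (Rd k) (\<lambda>l. H k i l \<omega> + u k i l \<omega>) (\<lambda>l. H k j l \<omega> + u k j l \<omega>)
            - rho_sq (Rd k) (\<lambda>l. H k i l \<omega>) (\<lambda>l. H k j l \<omega>) - 2 * \<sigma>\<^sup>2\<bar>"
            by (rule Sup_insert_0_gt_witness[OF _ lt]) (use w E \<tau>1 elim(4) in auto)
          then show "\<omega> \<in> {\<omega> \<in> space M. \<exists>i<n k. \<exists>j<n k. i \<noteq> j \<and>
           \<bar>rho_sq (Rd k) (\<lambda>l. H k i l \<omega> + u k i l \<omega>) (\<lambda>l. H k j l \<omega> + u k j l \<omega>)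
            - rho_sq (Rd k) (\<lambda>l. H k i l \<omega>) (\<lambda>l. H k j l \<omega>) - 2 * \<sigma>\<^sup>2\<bar> \<ge> 8 * ((1 + 2 * \<bar>Bd\<bar>) * K\<^sup>2 + 1) / \<tau> k}"
            using w unfolding E_def by (auto intro: less_imp_le)
        qed
        have me: "moment_event = {\<omega> \<in> space M. \<forall>kil\<in>{k} \<times> ({..<n k} \<times> Rd k). Y kil \<omega> \<le> ennreal K}"
          unfolding moment_event_def Y_def by auto
        have "measure M (?X \<epsilon> k) \<le> measure M (space M - moment_event)
             + real (n k) * real (card (Rd k)) * (\<tau> k powr (- Q) * K)
             + 6 * (real (n k))\<^sup>2 * exp ((1 + K)\<^sup>2 * real (card (Rd k)) / \<tau> k ^ 4
                 - real (card (Rd k)) / ((1 + 2 * \<bar>Bd\<bar>) * \<tau> k ^ 3))"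
          by (rule distance_deviation[OF HF HB _ \<tau>1 X]) auto
        moreover have "measure M (space M - moment_event) \<le> \<delta> / 3"
          unfolding me by (rule tight) auto
        ultimately show ?case using elim(1,2) unfolding L_def by linarith
      qed
    qed
  qed

  \<comment> \<open>Upper comparison with the latent distance\<close>
  have rho_upper: "rho_sq (Rd k) (\<lambda>l. H k i l \<omega>) (\<lambda>l. H k j l \<omega>)
       \<le> (real CARD('r) * Bd)\<^sup>2 * (norm (alpha k i \<omega> - alpha k j \<omega>))\<^sup>2" if "\<omega> \<in> space M" for k i j \<omega>
    unfolding H_def using smooth[OF _ that, unfolded mbar'] by (rule rho_sq_Lipschitz)

  \<comment> \<open>The Lipschitz bound is deterministic, so beyond the squared Lipschitz constant
    plus 1 the event is empty for every \<open>k\<close>.\<close>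
  have part_b_upper: "lesssim_P M
       (\<lambda>k \<omega>. Sup (insert 0 {ereal (rho_sq (Rd k) (\<lambda>l. H k i l \<omega>) (\<lambda>l. H k j l \<omega>)
             / norm (alpha k i \<omega> - alpha k j \<omega>) powr 2) | i j.
                   i < n k \<and> j < n k \<and> alpha k i \<omega> \<noteq> alpha k j \<omega>}))
       (\<lambda>k \<omega>. 1)"
  proof (rule lesssim_PI, intro exI allI impI always_eventually)
    fix \<delta> \<epsilon> :: real and k
    assume \<delta>: "\<delta> > 0" and \<epsilon>: "(real CARD('r) * Bd)\<^sup>2 + 1 \<le> \<epsilon>"
    have "{\<omega> \<in> space M. ereal \<epsilon> * \<bar>1\<bar> \<le> \<bar>Sup (insert 0 {ereal (rho_sq (Rd k) (\<lambda>l. H k i l \<omega>) (\<lambda>l. H k j l \<omega>)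
             / norm (alpha k i \<omega> - alpha k j \<omega>) powr 2) | i j.
                   i < n k \<and> j < n k \<and> alpha k i \<omega> \<noteq> alpha k j \<omega>})\<bar>} = {}"
      (is "{\<omega> \<in> space M. _ \<le> ?S \<omega>} = {}")
    proof (intro equals0I)
      fix \<omega> assume "\<omega> \<in> {\<omega> \<in> space M. ereal \<epsilon> * \<bar>1\<bar> \<le> ?S \<omega>}"
      then have w: "\<omega> \<in> space M" and "ereal \<epsilon> \<le> ?S \<omega>" by auto
      from Sup_insert_0_gt_witness[OF this(2), of "(real CARD('r) * Bd)\<^sup>2"] \<epsilon>
      obtain i j where ij: "alpha k i \<omega> \<noteq> alpha k j \<omega>"
        and "(real CARD('r) * Bd)\<^sup>2 < rho_sq (Rd k) (\<lambda>l. H k i l \<omega>) (\<lambda>l. H k j l \<omega>)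
             / norm (alpha k i \<omega> - alpha k j \<omega>) powr 2" by auto
      then show False using rho_upper[OF w, of k i j] by (simp add: powr_numeral field_simps)
    qed
    then show "measure M {\<omega> \<in> space M. ereal \<epsilon> * \<bar>1\<bar> \<le> \<bar>Sup (insert 0 {ereal (rho_sq (Rd k) (\<lambda>l. H k i l \<omega>) (\<lambda>l. H k j l \<omega>)
             / norm (alpha k i \<omega> - alpha k j \<omega>) powr 2) | i j.
                   i < n k \<and> j < n k \<and> alpha k i \<omega> \<noteq> alpha k j \<omega>})\<bar>} \<le> \<delta>"
      using \<delta> by (metis measure_empty less_imp_le)
  qed

  \<comment> \<open>Lower comparison with the latent distance\<close>
  define \<kappa> where "\<kappa> = c_lo\<^sup>2 / (real CARD('r) * (Bd\<^sup>2 + 1))"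
  have \<kappa>: "\<kappa> > 0" unfolding \<kappa>_def using c_lo_pos by (intro divide_pos_pos mult_pos_pos add_nonneg_pos) auto
  \<comment> \<open>\<open>W\<close> is the Taylor constant, increased by 1 to allow division when
    \<open>Bd = 0\<close>. The radius \<open>e0\<close> solves W r^2 = \<kappa>/4, so every pair
    within it satisfies the nearness condition of the local bound.\<close>
  define W where "W = (real CARD('r)) ^ 4 * Bd\<^sup>2 + 1"
  have W: "W > 0" unfolding W_def by (intro add_nonneg_pos) auto
  define e0 where "e0 = sqrt (\<kappa> / (4 * W))"
  have e0: "e0 > 0" using \<kappa> W by (simp add: e0_def)
  have e0_sq: "(real CARD('r)) ^ 4 * Bd\<^sup>2 * r\<^sup>2 \<le> \<kappa> / 4" if "0 \<le> r" "r \<le> e0" for r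
  proof -
    have "r\<^sup>2 \<le> e0\<^sup>2" using that by (intro power_mono) auto
    also have "\<dots> = \<kappa> / (4 * W)" using \<kappa> W by (simp add: e0_def)
    finally have "W * r\<^sup>2 \<le> \<kappa> / 4" using W by (simp add: field_simps)
    moreover have "(real CARD('r)) ^ 4 * Bd\<^sup>2 * r\<^sup>2 \<le> W * r\<^sup>2" unfolding W_def by (intro mult_right_mono) auto
    ultimately show ?thesis by linarith
  qed
  \<comment> \<open>Distances of latent points are bounded, so a fixed separation of the signals of
    far pairs is also a multiple of the squared latent distance.\<close>
  obtain D where D: "D > 0" "\<And>x y. x \<in> A \<Longrightarrow> y \<in> A \<Longrightarrow> norm (x - y) \<le> D"
  proof -
    obtain b where b: "b > 0" "\<And>x. x \<in> A \<Longrightarrow> norm x \<le> b"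
      using compact_imp_bounded[OF A_cpt] unfolding bounded_pos by blast
    have "norm (x - y) \<le> 2 * b" if "x \<in> A" "y \<in> A" for x y
      using norm_triangle_ineq4[of x y] b(2)[OF that(1)] b(2)[OF that(2)] by linarith
    then show ?thesis using that[of "2 * b"] b(1) by simp
  qed
  define S where "S k = {\<omega> \<in> space M. \<forall>i<n k.
        s_min (\<chi> a b. (1 / real (card (Rd k))) *
           (\<Sum>l\<in>Rd k. pderiv_at (eta k l \<omega>) a (alpha k i \<omega>) * pderiv_at (eta k l \<omega>) b (alpha k i \<omega>)))
        \<ge> c_lo}" for k
  define Z where "Z \<Delta> k = {\<omega> \<in> space M. \<exists>i<n k. \<exists>j<n k.
             rho_sq (Rd k) (\<lambda>l. H k i l \<omega>) (\<lambda>l. H k j l \<omega>) < \<Delta> \<and>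
             norm (alpha k i \<omega> - alpha k j \<omega>) > e0}" for \<Delta> k
  have ZM: "Z \<Delta> k \<in> sets M" for \<Delta> k
  proof -
    have "{\<omega> \<in> space M. rho_sq (Rd k) (\<lambda>l. H k i l \<omega>) (\<lambda>l. H k j l \<omega>) < \<Delta> \<and>
             norm (alpha k i \<omega> - alpha k j \<omega>) > e0} \<in> sets M" if "i < n k" "j < n k" for i j
    proof -
      note [measurable] = alphaM[OF that(1)] alphaM[OF that(2)]
      have [measurable]: "(\<lambda>\<omega>. rho_sq (Rd k) (\<lambda>l. H k i l \<omega>) (\<lambda>l. H k j l \<omega>)) \<in> borel_measurable M"
        unfolding rho_sq_def using HM[OF that(1)] HM[OF that(2)] by measurable
      show ?thesis by measurable
    qed
    moreover have "Z \<Delta> k = (\<Union>i\<in>{..<n k}. \<Union>j\<in>{..<n k}.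
         {\<omega> \<in> space M. rho_sq (Rd k) (\<lambda>l. H k i l \<omega>) (\<lambda>l. H k j l \<omega>) < \<Delta> \<and>
             norm (alpha k i \<omega> - alpha k j \<omega>) > e0})"
      unfolding Z_def by auto
    ultimately show ?thesis by (auto intro!: sets.finite_UN)
  qed

  have part_b_lower: "gtrsim_P M
       (\<lambda>k \<omega>. Inf {ereal (rho_sq (Rd k) (\<lambda>l. H k i l \<omega>) (\<lambda>l. H k j l \<omega>)
             / norm (alpha k i \<omega> - alpha k j \<omega>) powr 2) | i j.
                   i < n k \<and> j < n k \<and> alpha k i \<omega> \<noteq> alpha k j \<omega>})
       (\<lambda>k \<omega>. 1)"
    unfolding gtrsim_P_def
  proof (rule lesssim_PI)
    fix \<delta> :: real assume \<delta>: "\<delta> > 0"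
    obtain \<Delta> where \<Delta>: "\<Delta> > 0" "\<forall>\<^sub>F k in sequentially. measure M (Z \<Delta> k) \<le> \<delta> / 2"
      using limsup_small_at_right[OF hyp_iii[OF e0], of "\<delta> / 2"] \<delta> unfolding Z_def H_def by auto
    \<comment> \<open>Taking the maximum with 0 makes the measure of \<open>S k\<close> strictly
      positive. A non-measurable set has \<open>measure\<close> 0, so this yields measurability of
      \<open>S k\<close>, which is not otherwise evident for the infimum in
      \<open>s_min\<close>.\<close>
    have evS: "\<forall>\<^sub>F k in sequentially. measure M (S k) > max 0 (1 - \<delta> / 2)"
      using hyp_iv \<delta> unfolding S_def[symmetric] by (intro order_tendstoD(1)) auto
    \<comment> \<open>\<kappa>/4 serves pairs within \<open>e0\<close>. For farther pairs outside
      the exceptional event, the signal distance is at least \<Delta> and the latent one at most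
      \<open>D\<close>, which gives the ratio \<Delta>/D^2.\<close>
    define c1 where "c1 = min (\<kappa> / 4) (\<Delta> / D\<^sup>2)"
    have c1: "c1 > 0" using \<kappa> \<Delta> D by (simp add: c1_def)
    show "\<exists>E. \<forall>\<epsilon>\<ge>E. \<forall>\<^sub>F k in sequentially.
      measure M {\<omega> \<in> space M. ereal \<epsilon> * \<bar>Inf {ereal (rho_sq (Rd k) (\<lambda>l. H k i l \<omega>) (\<lambda>l. H k j l \<omega>)
             / norm (alpha k i \<omega> - alpha k j \<omega>) powr 2) | i j.
                   i < n k \<and> j < n k \<and> alpha k i \<omega> \<noteq> alpha k j \<omega>}\<bar> \<le> \<bar>1\<bar>} \<le> \<delta>"
      (is "\<exists>E. \<forall>\<epsilon>\<ge>E. \<forall>\<^sub>F k in sequentially. measure M (?X \<epsilon> k) \<le> \<delta>")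
    proof (intro exI[of _ "2 / c1"] allI impI)
      fix \<epsilon> assume \<epsilon>: "2 / c1 \<le> \<epsilon>"
      have \<epsilon>c: "\<epsilon> * c1 > 1" using \<epsilon> c1 by (simp add: field_simps)
      show "\<forall>\<^sub>F k in sequentially. measure M (?X \<epsilon> k) \<le> \<delta>"
        using \<Delta>(2) evS Rd_ne
      proof eventually_elim
        case (elim k)
        have SM: "S k \<in> sets M"
        proof (rule ccontr)
          assume "S k \<notin> sets M"
          then have "measure M (S k) = 0" by (rule measure_notin_sets)
          with elim(2) show False by simp
        qed
        have A: "AE \<omega> in M. \<forall>i\<in>{..<n k}. alpha k i \<omega> \<in> A"
          using distributed_AE_support[OF alpha_dist compact_imp_closed[OF A_cpt] f_out]
          by (subst AE_finite_all) auto
        have "measure M (?X \<epsilon> k) \<le> measure M ((space M - S k) \<union> Z \<Delta> k)"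
        proof (rule finite_measure_mono_AE)
          show "AE \<omega> in M. \<omega> \<in> ?X \<epsilon> k \<longrightarrow> \<omega> \<in> (space M - S k) \<union> Z \<Delta> k"
            using A
          proof eventually_elim
            case (elim \<omega>)
            show ?case
            proof (rule impI, rule ccontr)
              assume X: "\<omega> \<in> ?X \<epsilon> k" and n: "\<omega> \<notin> (space M - S k) \<union> Z \<Delta> k"
              then have w: "\<omega> \<in> space M" and wS: "\<omega> \<in> S k" and wZ: "\<omega> \<notin> Z \<Delta> k" by auto
              have "\<exists>i j. (i < n k \<and> j < n k \<and> alpha k i \<omega> \<noteq> alpha k j \<omega>) \<and>
                 rho_sq (Rd k) (\<lambda>l. H k i l \<omega>) (\<lambda>l. H k j l \<omega>) / norm (alpha k i \<omega> - alpha k j \<omega>) powr 2 < c1"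
                by (rule Inf_le_witness[OF _ \<epsilon>c c1]) (use X in simp)
              then obtain i j where ij: "i < n k" "j < n k" "alpha k i \<omega> \<noteq> alpha k j \<omega>"
                and r: "rho_sq (Rd k) (\<lambda>l. H k i l \<omega>) (\<lambda>l. H k j l \<omega>)
                   / norm (alpha k i \<omega> - alpha k j \<omega>) powr 2 < c1" by blast
              let ?r = "norm (alpha k i \<omega> - alpha k j \<omega>)"
              have r0: "?r > 0" using ij by simp
              with r have r': "rho_sq (Rd k) (\<lambda>l. H k i l \<omega>) (\<lambda>l. H k j l \<omega>) < c1 * ?r\<^sup>2"
                by (simp add: powr_numeral pos_divide_less_eq)
              show False
              proof (cases "?r > e0")
                case True
                have "\<not> (rho_sq (Rd k) (\<lambda>l. H k i l \<omega>) (\<lambda>l. H k j l \<omega>) < \<Delta> \<and> ?r > e0)"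
                  using wZ w ij(1,2) unfolding Z_def by blast
                with True have "\<Delta> \<le> rho_sq (Rd k) (\<lambda>l. H k i l \<omega>) (\<lambda>l. H k j l \<omega>)" by linarith
                moreover have "c1 * ?r\<^sup>2 \<le> \<Delta> / D\<^sup>2 * D\<^sup>2"
                  using elim ij D c1 by (intro mult_mono power_mono D(2)) (auto simp: c1_def)
                ultimately show False using r' D(1) by simp
              next
                case False
                have "\<kappa> / 4 * (norm (alpha k j \<omega> - alpha k i \<omega>))\<^sup>2 \<le>
                   rho_sq (Rd k) (\<lambda>l. eta k l \<omega> (alpha k i \<omega>)) (\<lambda>l. eta k l \<omega> (alpha k j \<omega>))"
                proof (rule rho_sq_local_lower[OF finRd \<open>Rd k \<noteq> {}\<close> mbar smooth[OF _ w] _ _ \<kappa>_def])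
                  show "(real CARD('r)) ^ 4 * Bd\<^sup>2 * (norm (alpha k j \<omega> - alpha k i \<omega>))\<^sup>2 \<le> \<kappa> / 4"
                    using False by (intro e0_sq) (auto simp: norm_minus_commute)
                qed (use c_lo_pos wS ij in \<open>auto simp: S_def\<close>)
                moreover have "c1 * ?r\<^sup>2 \<le> \<kappa> / 4 * ?r\<^sup>2"
                  unfolding c1_def by (intro mult_right_mono min.cobounded1) simp
                ultimately show False using r' unfolding H_def by (simp add: norm_minus_commute)
              qed
            qed
          qed
          show "(space M - S k) \<union> Z \<Delta> k \<in> sets M" using SM ZM by auto
        qed
        also have "\<dots> \<le> measure M (space M - S k) + measure M (Z \<Delta> k)"
          using SM ZM by (intro measure_Un_le) auto
        also have "\<dots> \<le> \<delta>" using elim prob_compl[OF SM] by simp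
        finally show ?case .
      qed
    qed
  qed

  show ?thesis
    unfolding indirect_matching_def
    using part_a part_b_upper part_b_lower a_pos matching_rate_tendsto_0[OF n_lim p_lim nu_pos rate]
    unfolding H_def a_def by simp
qed


end
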